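(* Let $J:(0,1]\to(0,\infty)$ be measurable with $\inf_{t\in(0,1]}J(t)/t>0$ and let $j\in\mathbb N$. Let $\|\cdot\|_{X(0,1)}$ be a rearrangement-invariant norm with $X(0,1)\ne L^1(0,1)$, and let $\|\cdot\|_{Y(0,1)}$ be a rearrangement-invariant norm with $\big\|\big(\int_t^1\frac{dr}{J(r)}\big)^j\big\|_{Y(0,1)}<\infty$. Then the following are equivalent: (i) $H^j_J:X(0,1)\rightarrow\rightarrow Y(0,1)$; (ii) $\lim_{a\to0_+}\sup_{\|f\|_{X(0,1)}\le1}\sup_{\lambda_1(E)\le a}\|H^j_J(\chi_Ef)\|_{Y(0,1)}=0$, the inner supremum over measurable $E\subseteq(0,1)$; (iii) $X(0,1)\overset{*}{\hookrightarrow}Y^d_{j,J}(0,1)$.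
   Context: Rearrangement-invariant norms: $f^*(t)=\inf\{\lambda\ge0:\lambda_1(\{|f|>\lambda\})\le t\}$. A rearrangement-invariant (r.i.) norm on $(0,1)$ is a functional $\|\cdot\|_{X(0,1)}$ on measurable functions with values in $[0,\infty]$ satisfying: for $f,g\ge0$, $a\ge0$, $\|f\|=0$ iff $f=0$ a.e., $\|af\|=a\|f\|$, $\|f+g\|\le\|f\|+\|g\|$; $f\le g$ a.e. $\Rightarrow\|f\|\le\|g\|$; $0\le f_k\uparrow f$ a.e. $\Rightarrow\|f_k\|\uparrow\|f\|$; $\|1\|<\infty$; $\int_0^1f\le C\|f\|$; equimeasurable functions have equal norm. $X(0,1)\ne L^1(0,1)$ means inequality as sets. $T:X(0,1)\rightarrow\rightarrow Y(0,1)$ means $T$ maps bounded subsets of $X(0,1)$ into relatively compact subsets of $Y(0,1)$. Almost-compact embedding: $X(0,1)\overset{*}{\hookrightarrow}Z(0,1)$ means $\lim_{a\to0_+}\sup_{\|f\|_{X(0,1)}\le1}\|\chi_{(0,a)}f^*\|_{Z(0,1)}=0$. Operator: $H^j_Jf(t)=\frac{1}{(j-1)!}\int_t^1\frac{|f(s)|}{J(s)}\big(\int_t^s\frac{dr}{J(r)}\big)^{j-1}ds$. $Y^d_{j,J}(0,1)$ is the r.i. space with norm $\|f\|_{Y^d_{j,J}(0,1)}=\sup_{h\sim f}\|H^j_Jh\|_{Y(0,1)}+\|f\|_{L^1(0,1)}$, supremum over all $h$ equimeasurable with $f$. *)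

theory Defs
  imports "HOL-Analysis.Analysis"
begin

text \<open>Functions on (0,1) are modelled as functions on the reals, considered on the
measure space (0,1) with Lebesgue measure.  A rearrangement-invariant norm is
modelled, as usual for Banach function norms, as a functional on nonnegative
[0,\<infinity>]-valued measurable functions; the norm of a real function f is the
value at the function |f|.\<close>

definition M01 :: "real measure" where
  "M01 = lebesgue_on {0<..<1}"

definition equimeasurable :: "(real \<Rightarrow> ennreal) \<Rightarrow> (real \<Rightarrow> ennreal) \<Rightarrow> bool" where
  "equimeasurable f g \<longleftrightarrow>
     (\<forall>c::ennreal. emeasure M01 {t \<in> space M01. c < f t} = emeasure M01 {t \<in> space M01. c < g t})"

definition rearr :: "(real \<Rightarrow> ennreal) \<Rightarrow> real \<Rightarrow> ennreal" where
  "rearr f t = Inf {c::ennreal. emeasure M01 {s \<in> space M01. c < f s} \<le> ennreal t}"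

definition ri_norm :: "((real \<Rightarrow> ennreal) \<Rightarrow> ennreal) \<Rightarrow> bool" where
  "ri_norm \<rho> \<longleftrightarrow>
     (\<forall>f \<in> borel_measurable M01. \<rho> f = 0 \<longleftrightarrow> (AE t in M01. f t = 0)) \<and>
     (\<forall>f \<in> borel_measurable M01. \<forall>a::real. a \<ge> 0 \<longrightarrow> \<rho> (\<lambda>t. ennreal a * f t) = ennreal a * \<rho> f) \<and>
     (\<forall>f \<in> borel_measurable M01. \<forall>g \<in> borel_measurable M01. \<rho> (\<lambda>t. f t + g t) \<le> \<rho> f + \<rho> g) \<and>
     (\<forall>f \<in> borel_measurable M01. \<forall>g \<in> borel_measurable M01.
        (AE t in M01. f t \<le> g t) \<longrightarrow> \<rho> f \<le> \<rho> g) \<and>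
     (\<forall>F f. (\<forall>k. F k \<in> borel_measurable M01) \<longrightarrow> f \<in> borel_measurable M01 \<longrightarrow>
        (AE t in M01. incseq (\<lambda>k. F k t) \<and> (\<lambda>k. F k t) \<longlonglongrightarrow> f t) \<longrightarrow>
        incseq (\<lambda>k. \<rho> (F k)) \<and> (\<lambda>k. \<rho> (F k)) \<longlonglongrightarrow> \<rho> f) \<and>
     \<rho> (\<lambda>t. 1) < \<infinity> \<and>
     (\<exists>C::real. \<forall>f \<in> borel_measurable M01. (\<integral>\<^sup>+ t. f t \<partial>M01) \<le> ennreal C * \<rho> f) \<and>
     (\<forall>f \<in> borel_measurable M01. \<forall>g \<in> borel_measurable M01. equimeasurable f g \<longrightarrow> \<rho> f = \<rho> g)"

definition ri_space :: "((real \<Rightarrow> ennreal) \<Rightarrow> ennreal) \<Rightarrow> (real \<Rightarrow> real) set" where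
  "ri_space \<rho> = {f. f \<in> borel_measurable M01 \<and> \<rho> (\<lambda>t. ennreal \<bar>f t\<bar>) < \<infinity>}"

definition L1_space :: "(real \<Rightarrow> real) set" where
  "L1_space = {f. f \<in> borel_measurable M01 \<and> integrable M01 f}"

definition Jint :: "(real \<Rightarrow> real) \<Rightarrow> real \<Rightarrow> real \<Rightarrow> ennreal" where
  "Jint J t s = (\<integral>\<^sup>+ r \<in> {t..s}. ennreal (1 / J r) \<partial>lebesgue)"

text \<open>H^j_J applied to a nonnegative function g (for real f one applies it to |f|).\<close>
definition Hop :: "(real \<Rightarrow> real) \<Rightarrow> nat \<Rightarrow> (real \<Rightarrow> ennreal) \<Rightarrow> real \<Rightarrow> ennreal" where
  "Hop J j g t = ennreal (1 / fact (j - 1)) *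
     (\<integral>\<^sup>+ s \<in> {t..1}. g s * ennreal (1 / J s) * (Jint J t s) ^ (j - 1) \<partial>lebesgue)"

definition Yd :: "(real \<Rightarrow> real) \<Rightarrow> nat \<Rightarrow> ((real \<Rightarrow> ennreal) \<Rightarrow> ennreal) \<Rightarrow> (real \<Rightarrow> ennreal) \<Rightarrow> ennreal" where
  "Yd J j \<rho> g = (SUP h \<in> {h \<in> borel_measurable M01. equimeasurable h g}. \<rho> (Hop J j h))
                 + (\<integral>\<^sup>+ t. g t \<partial>M01)"

definition compact_op :: "((real \<Rightarrow> ennreal) \<Rightarrow> ennreal) \<Rightarrow> ((real \<Rightarrow> ennreal) \<Rightarrow> ennreal)
    \<Rightarrow> ((real \<Rightarrow> real) \<Rightarrow> real \<Rightarrow> ennreal) \<Rightarrow> bool" where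
  "compact_op \<rho>X \<rho>Y T \<longleftrightarrow>
     (\<forall>f :: nat \<Rightarrow> real \<Rightarrow> real.
        (\<forall>n. f n \<in> borel_measurable M01) \<and> (\<exists>B::real. \<forall>n. \<rho>X (\<lambda>t. ennreal \<bar>f n t\<bar>) \<le> ennreal B) \<longrightarrow>
        (\<forall>n. \<rho>Y (T (f n)) < \<infinity>) \<and>
        (\<exists>r g. strict_mono r \<and> g \<in> ri_space \<rho>Y \<and>
           (\<lambda>n. \<rho>Y (\<lambda>t. ennreal \<bar>enn2real (T (f (r n)) t) - g t\<bar>)) \<longlonglongrightarrow> 0))"

definition almost_compact :: "((real \<Rightarrow> ennreal) \<Rightarrow> ennreal) \<Rightarrow> ((real \<Rightarrow> ennreal) \<Rightarrow> ennreal) \<Rightarrow> bool" where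
  "almost_compact \<rho>X \<rho>Z \<longleftrightarrow>
     ((\<lambda>a::real. SUP f \<in> {f \<in> borel_measurable M01. \<rho>X (\<lambda>t. ennreal \<bar>f t\<bar>) \<le> 1}.
         \<rho>Z (\<lambda>t. indicator {0<..<a} t * rearr (\<lambda>s. ennreal \<bar>f s\<bar>) t)) \<longlongrightarrow> 0) (at_right 0)"

end

theory Submission
  imports Defs "HOL-Complex_Analysis.Great_Picard"
begin

text \<open>
  The bridge between the three conditions is uniform integrability of the unit ball of \<open>X\<close>, which is
  where \<open>X \<noteq> L\<^sup>1\<close> enters: if it failed, averaging the rearrangements of the offending functions over
  cyclic shifts of a grid would give \<open>\<parallel>\<chi>\<^bsub>(0,1/n)\<^esub>\<parallel> \<le> C/n\<close> for all \<open>n\<close>, hence \<open>\<parallel>h\<parallel> \<le> 2C \<integral>h\<close> for all \<open>h\<close>, and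
  \<open>X\<close> would be \<open>L\<^sup>1\<close>.

  (ii) and (iii) are the same statement read through rearrangements, up to the \<open>L\<^sup>1\<close> term of the norm of
  \<open>Y\<^sup>d\<close>, which uniform integrability controls.  If (i) holds, then \<open>H(\<chi>\<^bsub>E\<^esub> f)\<close> tends to \<open>0\<close> locally
  uniformly on \<open>(0,1)\<close> as the measure of \<open>E\<close> shrinks, so \<open>0\<close> is the only possible limit in \<open>Y\<close>.
  Conversely, given (ii), the part of \<open>f\<close> living on \<open>(0,\<delta>)\<close> is negligible.  On the rest, with
  \<open>\<Phi>(t) = \<integral>\<^bsub>t\<^esub>\<^bsup>1\<^esup> dr/J(r)\<close>, the binomial theorem writes \<open>H f\<close> as a finite sum of terms \<open>\<Phi>\<^sup>i G\<^sub>i\<close>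
  with \<open>G\<^sub>i\<close> equicontinuous, and \<open>\<Phi>\<^sup>i \<le> 1 + \<Phi>\<^sup>j\<close> lies in \<open>Y\<close>; a diagonal argument and the
  Fatou property of \<open>Y\<close> then produce the limit.
\<close>

subsection \<open>Rearrangements and rearrangement-invariant norms\<close>

text \<open>Why averaging bounds the norm of an interval: let a step function on (0,1/n) have norm
  at most 1 and integral s. Its cyclic shifts are equimeasurable, so each has norm at most 1, and
  their mean is the constant n s on (0,1/n); hence that interval has norm at most 1/(n s). If s is
  at least \<epsilon>, this is C/n with C = 1/\<epsilon>. The factor 2 comes from rounding the
  measure of a set up to a whole number of cells.

  The obstacle in passing from (ii) to (i) is that a bounded sequence in X need not have a
  subsequence converging in L^1, so differences of images under H cannot be estimated through
  differences of the functions: only integrals against fixed weights converge. The kernel of H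
  depends on t and may be unbounded as t tends to 0, even when the function is cut off below
  \<delta>. Separating the variables moves this dependence out of the integrals into powers of
  \<Phi>(t), which the hypothesis on Y controls, and leaves weights in s alone that are bounded on
  [\<delta>,1).\<close>

lemma space_M01: "space M01 = {0<..<1}"
  by (simp add: M01_def)

lemma sets_M01: "A \<in> sets M01 \<longleftrightarrow> A \<in> sets lebesgue \<and> A \<subseteq> {0<..<1}"
  by (auto simp: M01_def sets_restrict_space_iff)

lemma emeasure_M01: "A \<subseteq> {0<..<1} \<Longrightarrow> emeasure M01 A = emeasure lebesgue A"
  by (simp add: M01_def emeasure_restrict_space)

lemma nn_integral_M01: "(\<integral>\<^sup>+ t. f t \<partial>M01) = (\<integral>\<^sup>+ t. f t * indicator {0<..<1} t \<partial>lebesgue)"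
  by (simp add: M01_def nn_integral_restrict_space)

lemma emeasure_M01_le_1: "emeasure M01 A \<le> 1"
proof -
  have "emeasure M01 A \<le> emeasure M01 (space M01)" by (rule emeasure_space)
  also have "\<dots> = 1" by (simp add: emeasure_M01 space_M01)
  finally show ?thesis .
qed

lemma finite_measure_M01: "finite_measure M01"
  using emeasure_M01_le_1[of "space M01"] by (intro finite_measureI) (auto simp: top_unique)

text \<open>Superlevel sets of a monotone function are intervals. This gives measurability of
  \<open>rearr f\<close>, \<open>Jint J t 1\<close> and \<open>Hop J j g\<close> without any
  measurability in two variables.\<close>

lemma antimono_on_borel_measurable_M01:
  fixes f :: "real \<Rightarrow> ennreal"
  assumes "\<And>s t. 0 < s \<Longrightarrow> s \<le> t \<Longrightarrow> t < 1 \<Longrightarrow> f t \<le> f s"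
  shows "f \<in> borel_measurable M01"
proof (rule borel_measurableI_greater)
  fix y
  have "is_interval {x \<in> {0<..<1}. y < f x}"
    unfolding is_interval_1 using assms by (auto intro: less_le_trans order_less_le_trans)
  then show "{x \<in> space M01. y < f x} \<in> sets M01"
    by (auto simp: sets_M01 space_M01 intro!: sets_completionI_sets real_interval_borel_measurable)
qed

lemma indicator_borel_measurable_M01 [measurable]:
  "A \<in> sets borel \<Longrightarrow> indicator A \<in> borel_measurable M01"
  unfolding M01_def by (intro measurable_restrict_space1 borel_measurable_indicator) auto

lemma emeasure_M01_Ioo: "0 \<le> a \<Longrightarrow> a \<le> 1 \<Longrightarrow> emeasure M01 {0<..<a} = ennreal a"
  by (subst emeasure_M01) auto

text \<open>The reverse direction is right-continuity of the distribution function: the sets where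
  \<open>f\<close> exceeds \<open>u n\<close> increase to the set where it exceeds \<open>c\<close>.
  So some \<open>u n\<close>, strictly above \<open>c\<close>, already has a superlevel set of
  measure more than \<open>t\<close>, and it bounds from below the set whose infimum is
  \<open>rearr f t\<close>.\<close>

lemma less_rearr_iff:
  assumes f [measurable]: "f \<in> borel_measurable M01"
  shows "c < rearr f t \<longleftrightarrow> ennreal t < emeasure M01 {s \<in> space M01. c < f s}"
proof
  assume "c < rearr f t"
  then show "ennreal t < emeasure M01 {s \<in> space M01. c < f s}"
    unfolding rearr_def using not_less Inf_lower by (metis (mono_tags, lifting) mem_Collect_eq)
next
  let ?m = "\<lambda>c. emeasure M01 {s \<in> space M01. c < f s}"
  assume *: "ennreal t < ?m c"
  \<comment> \<open>The level \<open>top\<close> is exceeded nowhere; finiteness of \<open>c\<close>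
    makes \<open>u n\<close> strictly larger than \<open>c\<close>.\<close>
  then have "c \<noteq> top" by auto
  define u where "u n = c + ennreal (1 / real (Suc n))" for n
  have "(\<lambda>n. ennreal (1 / real (Suc n))) \<longlonglongrightarrow> ennreal 0"
    by (intro tendsto_ennrealI LIMSEQ_Suc lim_1_over_n)
  then have "u \<longlonglongrightarrow> c + 0"
    unfolding u_def by (intro tendsto_add) auto
  moreover have "c < u n" for n
    using \<open>c \<noteq> top\<close> ennreal_add_left_cancel_less[of c 0 "ennreal (1 / real (Suc n))"]
    by (simp add: u_def)
  moreover have "decseq u"
    unfolding decseq_def u_def by (intro allI impI add_left_mono ennreal_leI) (simp add: frac_le)
  ultimately have u: "decseq u" "\<And>n. c < u n" "u \<longlonglongrightarrow> c" by auto
  have "(\<Union>n. {s \<in> space M01. u n < f s}) = {s \<in> space M01. c < f s}"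
    using u order_tendstoD(2)[OF u(3)] by (fastforce simp: eventually_sequentially intro: less_trans)
  moreover have "(\<lambda>n. ?m (u n)) \<longlonglongrightarrow> emeasure M01 (\<Union>n. {s \<in> space M01. u n < f s})"
    using u(1) by (intro Lim_emeasure_incseq) (auto simp: incseq_def decseq_def intro: le_less_trans)
  ultimately have "(\<lambda>n. ?m (u n)) \<longlonglongrightarrow> ?m c" by simp
  from order_tendstoD(1)[OF this *] obtain n where n: "ennreal t < ?m (u n)"
    by (auto simp: eventually_sequentially)
  have "u n \<le> rearr f t"
    unfolding rearr_def
  proof (rule Inf_greatest)
    fix d assume "d \<in> {c. ?m c \<le> ennreal t}"
    then have d: "?m d < ?m (u n)" using n by auto
    show "u n \<le> d"
    proof (rule ccontr)
      assume "\<not> u n \<le> d"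
      then have "?m (u n) \<le> ?m d"
        by (intro emeasure_mono) auto
      with d show False by simp
    qed
  qed
  with u(2)[of n] show "c < rearr f t" by (rule less_le_trans)
qed

lemma rearr_antimono: "s \<le> t \<Longrightarrow> rearr f t \<le> rearr f s"
  unfolding rearr_def by (rule Inf_superset_mono) (auto intro: order_trans ennreal_leI)

lemma borel_measurable_rearr [measurable]: "rearr f \<in> borel_measurable M01"
  by (rule antimono_on_borel_measurable_M01) (rule rearr_antimono)

lemma equimeasurable_sym: "equimeasurable f g \<Longrightarrow> equimeasurable g f"
  by (simp add: equimeasurable_def)

lemma equimeasurable_cong:
  assumes "\<And>t. 0 < t \<Longrightarrow> t < 1 \<Longrightarrow> g t = h t"
  shows "equimeasurable f g \<longleftrightarrow> equimeasurable f h"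
proof -
  have "{t \<in> space M01. c < g t} = {t \<in> space M01. c < h t}" for c using assms by (auto simp: space_M01)
  then show ?thesis by (simp add: equimeasurable_def)
qed

text \<open>By \<open>less_rearr_iff\<close>, the superlevel set of \<open>rearr f\<close> at
  \<open>c\<close> is the interval (0,m), where m is the measure of the superlevel set of
  \<open>f\<close>.\<close>

lemma equimeasurable_rearr:
  assumes f: "f \<in> borel_measurable M01"
  shows "equimeasurable (rearr f) f"
  unfolding equimeasurable_def
proof
  fix c
  let ?m = "emeasure M01 {s \<in> space M01. c < f s}"
  obtain m where m: "?m = ennreal m" "0 \<le> m" "m \<le> 1"
    using emeasure_M01_le_1[of "{s \<in> space M01. c < f s}"]
    by (cases ?m) (auto simp: top_unique)
  have "{t \<in> space M01. c < rearr f t} = {0<..<m}"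
    using m by (auto simp: space_M01 less_rearr_iff[OF f] ennreal_less_iff)
  then show "emeasure M01 {t \<in> space M01. c < rearr f t} = ?m"
    using m by (simp add: emeasure_M01_Ioo)
qed

text \<open>The two image measures are finite and agree on rays, a system closed under intersection,
  so they are equal.\<close>

lemma equimeasurable_nn_integral:
  assumes [measurable]: "f \<in> borel_measurable M01" "g \<in> borel_measurable M01"
    and eq: "equimeasurable f g"
  shows "(\<integral>\<^sup>+ t. f t \<partial>M01) = (\<integral>\<^sup>+ t. g t \<partial>M01)"
proof -
  interpret finite_measure M01 by (rule finite_measure_M01)
  \<comment> \<open>No ray \<open>{c<..}\<close> contains 0, so \<open>UNIV\<close> is added to the
    generator as the set of finite measure that exhausts the space.\<close>
  let ?E = "insert UNIV (range greaterThan :: ennreal set set)"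
  have sets: "sets (borel :: ennreal measure) = sigma_sets UNIV ?E"
    by (subst borel_Ioi, simp)
       (intro sigma_sets_eqI, auto intro: sigma_sets.Basic sigma_sets_top)
  have "distr M01 borel f = distr M01 borel g"
  proof (rule measure_eqI_generator_eq[where E = ?E and \<Omega> = UNIV and A = "\<lambda>_. UNIV"])
    have "{x<..} \<inter> {y<..} = {max x y<..}" for x y :: ennreal by auto
    then show "Int_stable ?E" by (auto simp: Int_stable_def)
    show "emeasure (distr M01 borel f) UNIV \<noteq> \<infinity>" for i :: nat
      by (simp add: emeasure_distr)
    fix X assume "X \<in> ?E"
    then consider "X = UNIV" | c where "X = {c<..}" by auto
    then show "emeasure (distr M01 borel f) X = emeasure (distr M01 borel g) X"
    proof cases
      case 1
      then show ?thesis by (simp add: emeasure_distr)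
    next
      case 2
      have "f -` {c<..} \<inter> space M01 = {t \<in> space M01. c < f t}"
        "g -` {c<..} \<inter> space M01 = {t \<in> space M01. c < g t}" by auto
      then show ?thesis using eq 2 by (simp add: emeasure_distr equimeasurable_def)
    qed
  qed (use sets in auto)
  then have "(\<integral>\<^sup>+ x. x \<partial>distr M01 borel f) = (\<integral>\<^sup>+ x. x \<partial>distr M01 borel g)" by simp
  then show ?thesis by (simp add: nn_integral_distr)
qed

lemma ri_norm_zero_iff:
  "ri_norm \<rho> \<Longrightarrow> f \<in> borel_measurable M01 \<Longrightarrow> \<rho> f = 0 \<longleftrightarrow> (AE t in M01. f t = 0)"
  unfolding ri_norm_def by blast

lemma ri_norm_scale:
  "ri_norm \<rho> \<Longrightarrow> f \<in> borel_measurable M01 \<Longrightarrow> 0 \<le> a \<Longrightarrow> \<rho> (\<lambda>t. ennreal a * f t) = ennreal a * \<rho> f"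
  unfolding ri_norm_def by blast

lemma ri_norm_add:
  "ri_norm \<rho> \<Longrightarrow> f \<in> borel_measurable M01 \<Longrightarrow> g \<in> borel_measurable M01 \<Longrightarrow>
    \<rho> (\<lambda>t. f t + g t) \<le> \<rho> f + \<rho> g"
  unfolding ri_norm_def by blast

lemma ri_norm_mono_AE:
  "ri_norm \<rho> \<Longrightarrow> f \<in> borel_measurable M01 \<Longrightarrow> g \<in> borel_measurable M01 \<Longrightarrow>
    AE t in M01. f t \<le> g t \<Longrightarrow> \<rho> f \<le> \<rho> g"
  unfolding ri_norm_def by blast

lemma ri_norm_mono:
  "ri_norm \<rho> \<Longrightarrow> f \<in> borel_measurable M01 \<Longrightarrow> g \<in> borel_measurable M01 \<Longrightarrow>
    (\<And>t. 0 < t \<Longrightarrow> t < 1 \<Longrightarrow> f t \<le> g t) \<Longrightarrow> \<rho> f \<le> \<rho> g"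
  by (rule ri_norm_mono_AE) (auto simp: space_M01)

lemma ri_norm_cong_AE:
  "ri_norm \<rho> \<Longrightarrow> f \<in> borel_measurable M01 \<Longrightarrow> g \<in> borel_measurable M01 \<Longrightarrow>
    AE t in M01. f t = g t \<Longrightarrow> \<rho> f = \<rho> g"
  by (intro antisym ri_norm_mono_AE) auto

lemma ri_norm_incseq_tendsto:
  assumes "ri_norm \<rho>" "\<And>k. F k \<in> borel_measurable M01" "f \<in> borel_measurable M01"
    and "AE t in M01. incseq (\<lambda>k. F k t) \<and> (\<lambda>k. F k t) \<longlonglongrightarrow> f t"
  shows "(\<lambda>k. \<rho> (F k)) \<longlonglongrightarrow> \<rho> f"
  using assms unfolding ri_norm_def by blast

lemma ri_norm_one_finite: "ri_norm \<rho> \<Longrightarrow> \<rho> (\<lambda>t. 1) < \<infinity>"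
  unfolding ri_norm_def by blast

lemma ri_norm_L1_bound:
  assumes "ri_norm \<rho>"
  obtains C where "0 < C" "\<And>f. f \<in> borel_measurable M01 \<Longrightarrow> (\<integral>\<^sup>+ t. f t \<partial>M01) \<le> ennreal C * \<rho> f"
proof -
  have "\<exists>C::real. \<forall>f \<in> borel_measurable M01. (\<integral>\<^sup>+ t. f t \<partial>M01) \<le> ennreal C * \<rho> f"
    using assms unfolding ri_norm_def by (elim conjE)
  then obtain C where C: "\<And>f. f \<in> borel_measurable M01 \<Longrightarrow> (\<integral>\<^sup>+ t. f t \<partial>M01) \<le> ennreal C * \<rho> f"
    by blast
  have "ennreal C * \<rho> f \<le> ennreal (max C 1) * \<rho> f" for f
    by (intro mult_right_mono ennreal_leI) auto
  then show ?thesis using C by (intro that[of "max C 1"]) (auto intro: order_trans)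
qed

lemma ri_norm_equimeasurable:
  "ri_norm \<rho> \<Longrightarrow> f \<in> borel_measurable M01 \<Longrightarrow> g \<in> borel_measurable M01 \<Longrightarrow>
    equimeasurable f g \<Longrightarrow> \<rho> f = \<rho> g"
  unfolding ri_norm_def by blast

lemma ri_norm_sum:
  assumes "ri_norm \<rho>" "finite I" "\<And>i. i \<in> I \<Longrightarrow> f i \<in> borel_measurable M01"
  shows "\<rho> (\<lambda>t. \<Sum>i\<in>I. f i t) \<le> (\<Sum>i\<in>I. \<rho> (f i))"
  using assms(2,3)
proof (induction I rule: finite_induct)
  case empty
  then show ?case using ri_norm_zero_iff[OF assms(1), of "\<lambda>t. 0"] by simp
next
  case (insert i I)
  have "\<rho> (\<lambda>t. f i t + (\<Sum>i\<in>I. f i t)) \<le> \<rho> (f i) + \<rho> (\<lambda>t. \<Sum>i\<in>I. f i t)"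
    using insert by (intro ri_norm_add[OF assms(1)]) auto
  also have "\<dots> \<le> \<rho> (f i) + (\<Sum>i\<in>I. \<rho> (f i))"
    using insert by (intro add_left_mono) auto
  finally show ?case using insert by simp
qed

text \<open>The infima over the tails of \<open>v\<close> increase to \<open>g\<close> and lie below
  each \<open>v n\<close> of the tail, so the monotone convergence axiom suffices.\<close>

lemma ri_norm_Fatou:
  assumes \<rho>: "ri_norm \<rho>" and v [measurable]: "\<And>n. v n \<in> borel_measurable M01"
    and g [measurable]: "g \<in> borel_measurable M01"
    and lim: "\<And>t. 0 < t \<Longrightarrow> t < 1 \<Longrightarrow> (\<lambda>n. v n t) \<longlonglongrightarrow> g t"
    and bd: "\<And>n. N \<le> n \<Longrightarrow> \<rho> (v n) \<le> e"
  shows "\<rho> g \<le> e"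
proof (rule LIMSEQ_le_const2)
  let ?F = "\<lambda>K t. INF m\<in>{K..}. v m t"
  show "(\<lambda>k. \<rho> (?F k)) \<longlonglongrightarrow> \<rho> g"
  proof (rule ri_norm_incseq_tendsto[OF \<rho>])
    show "AE t in M01. incseq (\<lambda>k. ?F k t) \<and> (\<lambda>k. ?F k t) \<longlonglongrightarrow> g t"
    proof (rule AE_I2, intro conjI)
      fix t assume t: "t \<in> space M01"
      show inc: "incseq (\<lambda>k. ?F k t)"
        unfolding incseq_def by (intro allI impI INF_superset_mono) auto
      have "liminf (\<lambda>n. v n t) = g t"
        using lim[of t] t by (simp add: space_M01, intro lim_imp_Liminf) auto
      then show "(\<lambda>k. ?F k t) \<longlonglongrightarrow> g t"
        using LIMSEQ_SUP[OF inc] by (simp add: liminf_SUP_INF)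
    qed
  qed auto
  show "\<exists>M. \<forall>n\<ge>M. \<rho> (?F n) \<le> e"
  proof (intro exI allI impI)
    fix n assume "N \<le> n"
    have "\<rho> (?F n) \<le> \<rho> (v n)"
      by (intro ri_norm_mono[OF \<rho>] INF_lower) auto
    with bd[OF \<open>N \<le> n\<close>] show "\<rho> (?F n) \<le> e" by simp
  qed
qed

subsection \<open>Uniform integrability of the unit ball\<close>

lemma sum_cyclic_shift:
  fixes \<phi> :: "nat \<Rightarrow> 'a::comm_monoid_add"
  shows "(\<Sum>k<N. \<phi> ((k + m) mod N)) = (\<Sum>k<N. \<phi> k)"
proof (induction m arbitrary: \<phi>)
  case 0
  then show ?case by simp
next
  case (Suc m)
  have "(\<Sum>k<N. \<phi> ((k + Suc m) mod N)) = (\<Sum>k<N. (\<lambda>x. \<phi> (Suc x mod N)) ((k + m) mod N))"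
    by (simp add: mod_Suc_eq)
  also have "\<dots> = (\<Sum>k<N. \<phi> (Suc k mod N))"
    by (rule Suc)
  also have "\<dots> = (\<Sum>k<N. \<phi> k)"
  proof (cases N)
    case (Suc n)
    have "(\<Sum>k<Suc n. \<phi> (Suc k mod Suc n)) = (\<Sum>k<n. \<phi> (Suc k)) + \<phi> 0" by simp
    also have "\<dots> = (\<Sum>k<Suc n. \<phi> k)"
      by (simp only: sum.lessThan_Suc_shift add.commute)
    finally show ?thesis using Suc by simp
  qed simp
  finally show ?case .
qed

text \<open>Without \<open>k < M\<close> the cell may leave (0,1), so only an upper bound holds. The
  index \<open>M\<close> does occur in \<open>ri_norm_indicator_le\<close> when
  \<open>n = 1\<close>.\<close>

lemma emeasure_M01_grid_le:
  assumes "0 < M"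
  shows "emeasure M01 ({real k / real M..<real (Suc k) / real M} \<inter> {0<..<1}) \<le> ennreal (1 / real M)"
proof -
  have "emeasure M01 ({real k / real M..<real (Suc k) / real M} \<inter> {0<..<1})
      \<le> emeasure lebesgue {real k / real M..<real (Suc k) / real M}"
    by (subst emeasure_M01) (auto intro!: emeasure_mono)
  also have "\<dots> = ennreal (1 / real M)"
    using assms by (simp add: field_simps)
  finally show ?thesis .
qed

text \<open>Intersecting with (0,1) removes at most the left endpoint 0 of the first cell, so the
  open cell still fits inside.\<close>

lemma emeasure_M01_grid:
  assumes "k < M"
  shows "emeasure M01 ({real k / real M..<real (Suc k) / real M} \<inter> {0<..<1}) = ennreal (1 / real M)"
proof (rule antisym)
  have "real (Suc k) / real M \<le> 1"
    using assms by (simp add: field_simps)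
  moreover have "0 \<le> real k / real M" by simp
  ultimately have "{real k / real M<..<real (Suc k) / real M}
      \<subseteq> {real k / real M..<real (Suc k) / real M} \<inter> {0<..<1}"
    by (meson Int_greatest greaterThanLessThan_subseteq_atLeastLessThan_iff
        greaterThanLessThan_subseteq_greaterThanLessThan order_refl)
  then have "emeasure lebesgue {real k / real M<..<real (Suc k) / real M}
      \<le> emeasure M01 ({real k / real M..<real (Suc k) / real M} \<inter> {0<..<1})"
    by (subst emeasure_M01) (auto intro!: emeasure_mono)
  moreover have "emeasure lebesgue {real k / real M<..<real (Suc k) / real M} = ennreal (1 / real M)"
    using assms by (simp add: field_simps)
  ultimately show "ennreal (1 / real M) \<le>
      emeasure M01 ({real k / real M..<real (Suc k) / real M} \<inter> {0<..<1})"
    by simp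
qed (use assms emeasure_M01_grid_le in auto)

lemma grid_floor:
  assumes "0 < t" "t < real N / real M" "0 < M"
  shows "nat \<lfloor>t * real M\<rfloor> < N"
    and "real (nat \<lfloor>t * real M\<rfloor>) / real M \<le> t" "t < real (Suc (nat \<lfloor>t * real M\<rfloor>)) / real M"
proof -
  have *: "real (nat \<lfloor>t * real M\<rfloor>) \<le> t * real M" "t * real M < real (nat \<lfloor>t * real M\<rfloor>) + 1"
    using assms by (simp_all add: of_nat_nat)
  then show "real (nat \<lfloor>t * real M\<rfloor>) / real M \<le> t" "t < real (Suc (nat \<lfloor>t * real M\<rfloor>)) / real M"
    using assms by (auto simp: field_simps)
  have "t * real M < real N"
    using assms by (simp add: field_simps)
  with *(1) show "nat \<lfloor>t * real M\<rfloor> < N" by linarith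
qed

lemma grid_floor_unique:
  assumes "real k / real M \<le> t" "t < real (Suc k) / real M" "0 < M"
  shows "nat \<lfloor>t * real M\<rfloor> = k"
proof -
  have "real k \<le> t * real M" "t * real M < real k + 1"
    using assms by (auto simp: field_simps)
  then have "\<lfloor>t * real M\<rfloor> = int k" by linarith
  then show ?thesis by simp
qed

text \<open>The interval (0,N/M) is cut into N cells of length 1/M. The rounded-down product is the
  index of the cell of \<open>t\<close>, and \<open>m\<close> rotates the values
  \<open>b 0, ..., b (N - 1)\<close> over the cells.\<close>

definition cyclic_step :: "(nat \<Rightarrow> ennreal) \<Rightarrow> nat \<Rightarrow> nat \<Rightarrow> nat \<Rightarrow> real \<Rightarrow> ennreal" where
  "cyclic_step b N M m t = b ((nat \<lfloor>t * real M\<rfloor> + m) mod N) * indicator {0<..<real N / real M} t"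

lemma borel_measurable_cyclic_step [measurable]: "cyclic_step b N M m \<in> borel_measurable M01"
proof -
  have "cyclic_step b N M m \<in> borel_measurable borel"
    unfolding cyclic_step_def by measurable
  then have "cyclic_step b N M m \<in> borel_measurable lebesgue"
    by (intro measurable_completion) simp
  then show ?thesis
    unfolding M01_def by (rule measurable_restrict_space1)
qed

text \<open>A superlevel set has measure 1/M times the number of cells whose value exceeds the
  level, and rotation preserves that number. The hypothesis \<open>N \<le> M\<close> keeps all cells
  within the unit interval.\<close>

lemma cyclic_step_equimeasurable:
  assumes "0 < N" "N \<le> M"
  shows "equimeasurable (cyclic_step b N M m) (cyclic_step b N M 0)"
proof -
  have "emeasure M01 {t \<in> space M01. c < cyclic_step b N M m t}
      = (\<Sum>k<N. if c < b k then ennreal (1 / real M) else 0)" for c m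
  proof -
    let ?I = "\<lambda>k. {real k / real M..<real (Suc k) / real M} \<inter> {0<..<1}"
    let ?K = "{k. k < N \<and> c < b ((k + m) mod N)}"
    have "{t \<in> space M01. c < cyclic_step b N M m t} = (\<Union>k\<in>?K. ?I k)" (is "?L = ?R")
    proof (intro equalityI subsetI)
      fix t assume "t \<in> ?L"
      then have t: "0 < t" "t < 1" "t < real N / real M" "c < b ((nat \<lfloor>t * real M\<rfloor> + m) mod N)"
        by (auto simp: cyclic_step_def space_M01 split: split_indicator_asm)
      then show "t \<in> ?R"
        using grid_floor[of t N M] assms by (intro UN_I[of "nat \<lfloor>t * real M\<rfloor>"]) auto
    next
      fix t assume "t \<in> ?R"
      then obtain k where k: "k < N" "c < b ((k + m) mod N)" "t \<in> ?I k" by auto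
      then have "nat \<lfloor>t * real M\<rfloor> = k" using grid_floor_unique[of k M t] assms by auto
      moreover have "t < real N / real M"
      proof -
        have "real (Suc k) / real M \<le> real N / real M"
          using k assms by (intro divide_right_mono) auto
        then show ?thesis using k by auto
      qed
      ultimately show "t \<in> ?L" using k by (auto simp: cyclic_step_def space_M01)
    qed
    moreover have "emeasure M01 (\<Union>k\<in>?K. ?I k) = (\<Sum>k\<in>?K. emeasure M01 (?I k))"
    proof (rule sum_emeasure[symmetric])
      show "disjoint_family_on ?I ?K"
        unfolding disjoint_family_on_def
      proof (intro ballI impI)
        fix k l :: nat assume "k \<noteq> l"
        then show "?I k \<inter> ?I l = {}"
          using grid_floor_unique[of k M] grid_floor_unique[of l M] assms by fastforce
      qed
    qed (auto simp: sets_M01)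
    moreover have "\<dots> = (\<Sum>k\<in>?K. ennreal (1 / real M))"
      using assms by (intro sum.cong emeasure_M01_grid) auto
    moreover have "\<dots> = (\<Sum>k<N. if c < b ((k + m) mod N) then ennreal (1 / real M) else 0)"
      by (subst sum.inter_filter[symmetric]) (auto intro!: arg_cong[where f = card])
    moreover have "\<dots> = (\<Sum>k<N. if c < b k then ennreal (1 / real M) else 0)"
      by (rule sum_cyclic_shift[where \<phi> = "\<lambda>k. if c < b k then ennreal (1 / real M) else 0"])
    ultimately show ?thesis by simp
  qed
  then show ?thesis by (simp add: equimeasurable_def)
qed

text \<open>At a point of (0,N/M) the N rotations take each value \<open>b k\<close> exactly once,
  so their sum is constant there, while all of them have the norm of the unrotated function.\<close>

lemma ri_norm_average:
  assumes \<rho>: "ri_norm \<rho>" and N: "0 < N" "N \<le> M" and s: "0 \<le> s" "ennreal s \<le> (\<Sum>k<N. b k)"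
  shows "ennreal s * \<rho> (indicator {0<..<real N / real M}) \<le> of_nat N * \<rho> (cyclic_step b N M 0)"
proof -
  have "ennreal s * \<rho> (indicator {0<..<real N / real M})
      = \<rho> (\<lambda>t. ennreal s * indicator {0<..<real N / real M} t)"
    using s by (subst ri_norm_scale[OF \<rho>]) auto
  also have "\<dots> \<le> \<rho> (\<lambda>t. \<Sum>m<N. cyclic_step b N M m t)"
  proof (rule ri_norm_mono[OF \<rho>])
    fix t :: real
    have "(\<Sum>m<N. cyclic_step b N M m t)
        = (\<Sum>m<N. b ((m + nat \<lfloor>t * real M\<rfloor>) mod N)) * indicator {0<..<real N / real M} t"
      by (simp add: cyclic_step_def sum_distrib_right add.commute)
    also have "\<dots> = (\<Sum>k<N. b k) * indicator {0<..<real N / real M} t"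
      by (simp only: sum_cyclic_shift)
    finally show "ennreal s * indicator {0<..<real N / real M} t \<le> (\<Sum>m<N. cyclic_step b N M m t)"
      using s by (simp add: mult_right_mono)
  qed auto
  also have "\<dots> \<le> (\<Sum>m<N. \<rho> (cyclic_step b N M m))"
    by (rule ri_norm_sum[OF \<rho>]) auto
  also have "\<dots> = (\<Sum>m<N. \<rho> (cyclic_step b N M 0))"
    using N by (intro sum.cong refl ri_norm_equimeasurable[OF \<rho>] cyclic_step_equimeasurable) auto
  finally show ?thesis by simp
qed

text \<open>The value \<open>b k\<close> of \<open>rearr f\<close> at the right end of cell k is a
  lower bound for \<open>rearr f\<close> on cell k and an upper bound on cell k+1. The first fact
  gives the step function norm at most 1; the second makes its integral dominate that of
  \<open>rearr f\<close> over all cells but the first, hence exceed \<epsilon>. Averaging then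
  applies.\<close>

lemma ri_norm_indicator_le:
  assumes \<rho>: "ri_norm \<rho>" and f [measurable]: "f \<in> borel_measurable M01" and "\<rho> f \<le> 1" and n: "0 < n"
    and \<epsilon>: "0 < \<epsilon>" "ennreal \<epsilon> < (\<integral>\<^sup>+ t. rearr f t * indicator {0<..<1 / real n} t \<partial>M01)"
  shows "\<rho> (indicator {0<..<1 / real n}) \<le> ennreal (1 / \<epsilon> / real n)"
proof -
  \<comment> \<open>The truncation drops the first cell of the future grid, where no grid value
    bounds \<open>rearr f\<close> from above. By monotone convergence the integral still exceeds
    \<epsilon> once the grid is fine.\<close>
  let ?F = "\<lambda>N t. rearr f t * indicator {1 / (real n * real (Suc N))..<1 / real n} t"
  have inc: "1 / (real n * real (Suc N')) \<le> 1 / (real n * real (Suc N))" if "N \<le> N'" for N N'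
    using that n by (intro divide_left_mono mult_left_mono) auto
  have sup: "(SUP N. ?F N t) = rearr f t * indicator {0<..<1 / real n} t" for t
  proof (cases "t \<in> {0<..<1 / real n}")
    case True
    obtain N where "1 / (real n * t) < real (Suc N)"
      by (meson reals_Archimedean2 less_SucI of_nat_less_iff less_trans lessI)
    then have "1 / (real n * real (Suc N)) \<le> t"
      using True n by (simp add: divide_le_eq divide_less_eq mult_ac)
    then have "?F N t = rearr f t" using True by simp
    moreover have "?F N t \<le> rearr f t" for N by (simp split: split_indicator)
    ultimately have "(SUP N. ?F N t) = rearr f t"
      by (intro antisym SUP_least SUP_upper2[of N]) auto
    then show ?thesis using True by simp
  next
    case False
    have "?F N t = 0" for N
    proof -
      have "0 < 1 / (real n * real (Suc N))" using n by simp
      then have "t \<notin> {1 / (real n * real (Suc N))..<1 / real n}"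
        using False order.strict_trans2[of 0 "1 / (real n * real (Suc N))" t] by auto
      then show ?thesis by simp
    qed
    then have "(SUP N. ?F N t) = (SUP N::nat. 0)" by (rule SUP_cong[OF refl])
    then show ?thesis using False by simp
  qed
  have "(SUP N. \<integral>\<^sup>+ t. ?F N t \<partial>M01) = (\<integral>\<^sup>+ t. rearr f t * indicator {0<..<1 / real n} t \<partial>M01)"
    unfolding sup[symmetric]
  proof (rule nn_integral_monotone_convergence_SUP[symmetric])
    show "incseq ?F"
    proof (rule incseq_SucI, rule le_funI)
      fix N t
      show "?F N t \<le> ?F (Suc N) t"
        using inc[of N "Suc N"] by (auto split: split_indicator)
    qed
  qed measurable
  with \<epsilon>(2) have "ennreal \<epsilon> < (SUP N. \<integral>\<^sup>+ t. ?F N t \<partial>M01)" by simp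
  then obtain N0 where N0: "ennreal \<epsilon> < (\<integral>\<^sup>+ t. ?F N0 t \<partial>M01)"
    unfolding less_SUP_iff by blast
  define N where "N = Suc N0"
  \<comment> \<open>With this mesh N/M = 1/n, so the N cells fill exactly (0,1/n).\<close>
  define M where "M = n * N"
  define b where "b k = rearr f (real (Suc k) / real M)" for k
  have "0 < N" by (simp add: N_def)
  with n have NM: "0 < N" "N \<le> M" "0 < M" "real N / real M = 1 / real n" by (auto simp: M_def)
  let ?I = "\<lambda>k. {real k / real M..<real (Suc k) / real M} \<inter> {0<..<1}"
  have "(\<integral>\<^sup>+ t. ?F N0 t \<partial>M01) \<le> (\<integral>\<^sup>+ t. (\<Sum>k<N. b k * indicator (?I (Suc k)) t) \<partial>M01)"
  proof (rule nn_integral_mono)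
    fix t assume "t \<in> space M01"
    then have t01: "0 < t" "t < 1" by (auto simp: space_M01)
    show "?F N0 t \<le> (\<Sum>k<N. b k * indicator (?I (Suc k)) t)"
    proof (cases "1 / real M \<le> t \<and> t < 1 / real n")
      case True
      define k where "k = nat \<lfloor>t * real M\<rfloor>"
      have k: "k < N" "real k / real M \<le> t" "t < real (Suc k) / real M"
        using grid_floor[of t N M] t01 True NM unfolding k_def by auto
      have "1 \<le> t * real M" using True NM by (simp add: field_simps)
      then have "1 \<le> k" unfolding k_def by linarith
      then obtain i where i: "k = Suc i" by (cases k) auto
      have "?F N0 t \<le> b i"
        unfolding b_def using k(2) i by (auto split: split_indicator intro: rearr_antimono)
      also have "\<dots> = b i * indicator (?I (Suc i)) t"
        using k i t01 by simp
      also have "\<dots> \<le> (\<Sum>k<N. b k * indicator (?I (Suc k)) t)"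
        using k(1) i by (intro member_le_sum) auto
      finally show ?thesis .
    next
      case False
      then have "t \<notin> {1 / (real n * real (Suc N0))..<1 / real n}"
        unfolding M_def N_def by (simp only: of_nat_mult atLeastLessThan_iff not_False_eq_True)
      then have "?F N0 t = 0" by simp
      then show ?thesis by (simp only: zero_le)
    qed
  qed
  also have "\<dots> = (\<Sum>k<N. b k * emeasure M01 (?I (Suc k)))"
    by (subst nn_integral_sum) (auto simp: nn_integral_cmult_indicator sets_M01)
  also have "\<dots> \<le> (\<Sum>k<N. b k * ennreal (1 / real M))"
    using NM by (intro sum_mono mult_left_mono emeasure_M01_grid_le) auto
  also have "\<dots> = (\<Sum>k<N. b k) * ennreal (1 / real M)"
    by (simp add: sum_distrib_right)
  finally have "ennreal \<epsilon> \<le> (\<Sum>k<N. b k) * ennreal (1 / real M)"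
    using N0 by simp
  then have "ennreal \<epsilon> * ennreal (real M) \<le> (\<Sum>k<N. b k) * ennreal (1 / real M) * ennreal (real M)"
    by (rule mult_right_mono) simp
  also have "\<dots> = (\<Sum>k<N. b k)"
    using NM by (simp add: mult.assoc ennreal_mult[symmetric] del: ennreal_of_nat_eq_real_of_nat)
  finally have s: "ennreal (\<epsilon> * real M) \<le> (\<Sum>k<N. b k)"
    using \<epsilon>(1) by (simp add: ennreal_mult)
  have "\<rho> (cyclic_step b N M 0) \<le> \<rho> (rearr f)"
  proof (rule ri_norm_mono[OF \<rho>])
    fix t :: real assume t: "0 < t" "t < 1"
    show "cyclic_step b N M 0 t \<le> rearr f t"
    proof (cases "t < real N / real M")
      case True
      then show ?thesis
        using grid_floor[of t N M] t NM
        by (auto simp: cyclic_step_def b_def intro!: rearr_antimono)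
    qed (simp add: cyclic_step_def)
  qed auto
  also have "\<dots> = \<rho> f"
    by (intro ri_norm_equimeasurable[OF \<rho>] equimeasurable_rearr) auto
  finally have "\<rho> (cyclic_step b N M 0) \<le> 1" using \<open>\<rho> f \<le> 1\<close> by simp
  then have "of_nat N * \<rho> (cyclic_step b N M 0) \<le> of_nat N * 1"
    by (rule mult_left_mono) simp
  moreover have "0 \<le> \<epsilon> * real M" using \<epsilon>(1) by simp
  ultimately have "ennreal (\<epsilon> * real M) * \<rho> (indicator {0<..<1 / real n}) \<le> of_nat N"
    using ri_norm_average[OF \<rho> NM(1,2) _ s] unfolding NM(4) by simp
  then have "ennreal (1 / (\<epsilon> * real M)) * (ennreal (\<epsilon> * real M) * \<rho> (indicator {0<..<1 / real n}))
      \<le> ennreal (1 / (\<epsilon> * real M)) * of_nat N"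
    by (rule mult_left_mono) simp
  moreover have "ennreal (1 / (\<epsilon> * real M)) * ennreal (\<epsilon> * real M) = 1"
    using NM \<epsilon>(1) by (simp add: ennreal_mult[symmetric])
  moreover have "ennreal (1 / (\<epsilon> * real M)) * of_nat N = ennreal (1 / \<epsilon> / real n)"
    using NM \<epsilon>(1) by (simp add: ennreal_of_nat_eq_real_of_nat ennreal_mult[symmetric] M_def)
  ultimately show ?thesis by (simp add: mult.assoc[symmetric])
qed

section \<open>From norms of short intervals to the L^1 norm\<close>

text \<open>The indicator of a set of measure \<open>m\<close> is equimeasurable with that of (0,m),
  so only lengths matter.\<close>

lemma ri_norm_indicator_mono:
  assumes \<rho>: "ri_norm \<rho>" and A: "A \<in> sets M01" "emeasure M01 A \<le> ennreal a"
  shows "\<rho> (indicator A) \<le> \<rho> (indicator {0<..<a})"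
proof -
  obtain m where m: "emeasure M01 A = ennreal m" "0 \<le> m" "m \<le> 1"
    using emeasure_M01_le_1[of A] by (cases "emeasure M01 A") (auto simp: top_unique)
  \<comment> \<open>For \<open>m = 0\<close> the inequality can fail, because \<open>a\<close> may
    be negative; then \<open>{0<..<m}\<close> is empty anyway.\<close>
  have "m \<le> a" if "m > 0" using A(2) m that by (metis ennreal_le_iff2 not_less)
  have "{t \<in> space M01. c < indicator A t} = (if c < 1 then A else {})"
    "{t \<in> space M01. c < indicator {0<..<m} t} = (if c < 1 then {0<..<m} else {})" for c :: ennreal
    using A(1) m by (auto simp: sets_M01 space_M01 split: split_indicator_asm)
  then have "equimeasurable (indicator A) (indicator {0<..<m})"
    using m by (simp add: equimeasurable_def emeasure_M01_Ioo)
  then have "\<rho> (indicator A) = \<rho> (indicator {0<..<m})"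
    using A by (intro ri_norm_equimeasurable[OF \<rho>]) auto
  also have "\<dots> \<le> \<rho> (indicator {0<..<a})"
    using \<open>m > 0 \<Longrightarrow> m \<le> a\<close> by (intro ri_norm_mono[OF \<rho>]) (auto split: split_indicator)
  finally show ?thesis .
qed

text \<open>Indicators are handled by covering (0,m) with cells of length 1/n, each of norm at most
  C/n. The bound then spreads to all measurable functions, because its left side is subadditive and
  passes to increasing limits while the integral is additive and monotone.\<close>

lemma ri_norm_le_L1:
  assumes \<rho>: "ri_norm \<rho>" and C: "0 \<le> C"
    and bd: "\<And>n. 0 < n \<Longrightarrow> \<rho> (indicator {0<..<1 / real n}) \<le> ennreal (C / real n)"
    and h: "h \<in> borel_measurable M01"
  shows "\<rho> h \<le> ennreal (2 * C) * (\<integral>\<^sup>+ t. h t \<partial>M01)"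
  using h
proof (induction rule: borel_measurable_induct)
  case (cong f g)
  have "\<rho> f = \<rho> g"
    using cong by (intro ri_norm_cong_AE[OF \<rho>]) auto
  moreover have "integral\<^sup>N M01 f = integral\<^sup>N M01 g"
    using cong by (intro nn_integral_cong) auto
  ultimately show ?case using cong by simp
next
  case (set A)
  obtain m where m: "emeasure M01 A = ennreal m" "0 \<le> m" "m \<le> 1"
    using emeasure_M01_le_1[of A] by (cases "emeasure M01 A") (auto simp: top_unique)
  show ?case
  proof (cases "m = 0")
    case True
    then have "AE t in M01. indicator A t = (0::ennreal)"
      using set m by (intro AE_I[of _ _ A]) (auto split: split_indicator)
    then show ?thesis using ri_norm_zero_iff[OF \<rho>, of "indicator A"] set by simp
  next
    case False
    then have "0 < m" using m by simp
    \<comment> \<open>Since 1/n \<le> m, the K cells covering (0,m) have total length K/n \<le> m +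
      1/n \<le> 2m. This is the origin of the factor 2.\<close>
    define n where "n = nat \<lceil>1 / m\<rceil>"
    have "1 / m \<le> real n" unfolding n_def by linarith
    moreover have "0 < 1 / m" using \<open>0 < m\<close> by simp
    ultimately have n: "0 < n" "1 / real n \<le> m"
      using \<open>0 < m\<close> by (auto simp: divide_le_eq mult_ac intro!: Nat.gr0I)
    define K where "K = nat \<lceil>m * real n\<rceil>"
    have "0 \<le> m * real n" using m by simp
    then have K: "m * real n \<le> real K" "real K \<le> m * real n + 1"
      unfolding K_def by linarith+
    let ?I = "\<lambda>k. {real k / real n..<real (Suc k) / real n} \<inter> {0<..<1}"
    have "\<rho> (indicator A) \<le> \<rho> (indicator {0<..<m})"
      using set m by (intro ri_norm_indicator_mono[OF \<rho>]) auto
    also have "\<dots> \<le> \<rho> (\<lambda>t. \<Sum>k<K. indicator (?I k) t)"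
    proof (rule ri_norm_mono[OF \<rho>])
      fix t :: real assume t: "0 < t" "t < 1"
      show "indicator {0<..<m} t \<le> (\<Sum>k<K. indicator (?I k) t :: ennreal)"
      proof (cases "t < m")
        case True
        moreover have "m \<le> real K / real n" using K n by (simp add: field_simps)
        ultimately have k: "nat \<lfloor>t * real n\<rfloor> < K" "t \<in> ?I (nat \<lfloor>t * real n\<rfloor>)"
          using grid_floor[of t K n] t n by auto
        then have "indicator {0<..<m} t = (indicator (?I (nat \<lfloor>t * real n\<rfloor>)) t :: ennreal)"
          using True t by simp
        also have "\<dots> \<le> (\<Sum>k<K. indicator (?I k) t)"
          using k by (intro member_le_sum) auto
        finally show ?thesis .
      qed simp
    qed auto
    also have "\<dots> \<le> (\<Sum>k<K. \<rho> (indicator (?I k)))"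
      by (rule ri_norm_sum[OF \<rho>]) auto
    also have "\<dots> \<le> (\<Sum>k<K. ennreal (C / real n))"
    proof (rule sum_mono)
      fix k
      have "\<rho> (indicator (?I k)) \<le> \<rho> (indicator {0<..<1 / real n})"
        using n by (intro ri_norm_indicator_mono[OF \<rho>] emeasure_M01_grid_le) (auto simp: sets_M01)
      then show "\<rho> (indicator (?I k)) \<le> ennreal (C / real n)"
        using bd[OF n(1)] by (rule order_trans)
    qed
    also have "\<dots> = ennreal (real K * (C / real n))"
      using C by (simp add: ennreal_of_nat_eq_real_of_nat ennreal_mult[symmetric])
    also have "\<dots> \<le> ennreal (2 * C * m)"
    proof (rule ennreal_leI)
      have "real K * (C / real n) \<le> (m * real n + 1) * (C / real n)"
        using K C by (intro mult_right_mono) auto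
      also have "\<dots> = C * (m + 1 / real n)" using n by (simp add: field_simps)
      also have "\<dots> \<le> C * (m + m)" using n C by (intro mult_left_mono) auto
      finally show "real K * (C / real n) \<le> 2 * C * m" by simp
    qed
    finally show ?thesis using set m C by (simp add: ennreal_mult)
  qed
next
  case (mult u c)
  then obtain r where r: "c = ennreal r" "0 \<le> r" by (cases c) auto
  have "\<rho> (\<lambda>x. c * u x) = c * \<rho> u" using mult r by (simp add: ri_norm_scale[OF \<rho>])
  also have "\<dots> \<le> c * (ennreal (2 * C) * integral\<^sup>N M01 u)" using mult by (intro mult_left_mono) auto
  finally show ?case using mult by (simp add: nn_integral_cmult ac_simps)
next
  case (add u v)
  have "\<rho> (\<lambda>x. v x + u x) \<le> \<rho> v + \<rho> u" using add by (intro ri_norm_add[OF \<rho>]) auto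
  also have "\<dots> \<le> ennreal (2 * C) * integral\<^sup>N M01 v + ennreal (2 * C) * integral\<^sup>N M01 u"
    using add by (intro add_mono) auto
  finally show ?case using add by (simp add: nn_integral_add distrib_left)
next
  case (seq U)
  have [measurable]: "\<And>i. U i \<in> borel_measurable M01" by (rule seq)
  have "(SUP i. U i) = (\<lambda>t. SUP i. U i t)" by (simp add: fun_eq_iff image_comp)
  then have [measurable]: "(SUP i. U i) \<in> borel_measurable M01" by simp
  show ?case
  proof (rule LIMSEQ_le_const2)
    show "(\<lambda>k. \<rho> (U k)) \<longlonglongrightarrow> \<rho> (SUP i. U i)"
    proof (rule ri_norm_incseq_tendsto[OF \<rho>])
      show "AE t in M01. incseq (\<lambda>k. U k t) \<and> (\<lambda>k. U k t) \<longlonglongrightarrow> (SUP i. U i) t"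
      proof (rule AE_I2)
        fix t
        have "incseq (\<lambda>k. U k t)" using seq by (auto simp: incseq_def le_fun_def)
        then show "incseq (\<lambda>k. U k t) \<and> (\<lambda>k. U k t) \<longlonglongrightarrow> (SUP i. U i) t"
          using LIMSEQ_SUP[of "\<lambda>k. U k t"] by (simp add: image_comp)
      qed
    qed auto
    show "\<exists>N. \<forall>n\<ge>N. \<rho> (U n) \<le> ennreal (2 * C) * integral\<^sup>N M01 (SUP i. U i)"
    proof (intro exI allI impI)
      fix n
      have "\<rho> (U n) \<le> ennreal (2 * C) * integral\<^sup>N M01 (U n)" by (rule seq)
      also have "\<dots> \<le> ennreal (2 * C) * integral\<^sup>N M01 (SUP i. U i)"
        by (intro mult_left_mono nn_integral_mono) (auto simp: SUP_apply intro: SUP_upper)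
      finally show "\<rho> (U n) \<le> ennreal (2 * C) * integral\<^sup>N M01 (SUP i. U i)" .
    qed
  qed
qed

text \<open>A failing pair for \<open>a = 1/n\<close> feeds \<open>ri_norm_indicator_le\<close> with
  the same \<epsilon> for every n, which gives \<open>ri_norm_le_L1\<close> with C = 1/\<epsilon>.
  Together with the L^1 axiom, finite norm and finite integral then coincide.\<close>

lemma ri_ball_uniformly_integrable:
  assumes \<rho>: "ri_norm \<rho>" and ne: "ri_space \<rho> \<noteq> L1_space" and \<epsilon>: "0 < \<epsilon>"
  shows "\<exists>a>0. \<forall>f E. f \<in> borel_measurable M01 \<longrightarrow> \<rho> f \<le> 1 \<longrightarrow> E \<in> sets M01 \<longrightarrow>
    emeasure M01 E \<le> ennreal a \<longrightarrow> (\<integral>\<^sup>+ t. f t * indicator E t \<partial>M01) \<le> ennreal \<epsilon>"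
proof (rule ccontr)
  assume "\<not> ?thesis"
  then have neg: "\<exists>f E. f \<in> borel_measurable M01 \<and> \<rho> f \<le> 1 \<and> E \<in> sets M01 \<and>
      emeasure M01 E \<le> ennreal a \<and> ennreal \<epsilon> < (\<integral>\<^sup>+ t. f t * indicator E t \<partial>M01)" if "0 < a" for a
    using that by (meson not_less)
  have "\<rho> (indicator {0<..<1 / real n}) \<le> ennreal (1 / \<epsilon> / real n)" if n: "0 < n" for n
  proof -
    obtain f E where [measurable]: "f \<in> borel_measurable M01" "E \<in> sets M01" and "\<rho> f \<le> 1"
      and E: "emeasure M01 E \<le> ennreal (1 / real n)"
      and int: "ennreal \<epsilon> < (\<integral>\<^sup>+ t. f t * indicator E t \<partial>M01)"
      using neg[of "1 / real n"] n by auto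
    define g where "g t = f t * indicator E t" for t
    have g [measurable]: "g \<in> borel_measurable M01" unfolding g_def by measurable
    have "\<rho> g \<le> \<rho> f" unfolding g_def
      by (intro ri_norm_mono[OF \<rho>]) (auto split: split_indicator)
    then have "\<rho> g \<le> 1" using \<open>\<rho> f \<le> 1\<close> by simp
    \<comment> \<open>The support of \<open>g\<close> lies in \<open>E\<close>, of measure at most
      1/n, so \<open>rearr g\<close> carries all its mass on (0,1/n).\<close>
    have zero: "rearr g t = 0" if "1 / real n \<le> t" for t
    proof -
      have "emeasure M01 {s \<in> space M01. 0 < g s} \<le> emeasure M01 E"
        by (intro emeasure_mono) (auto simp: g_def split: split_indicator_asm)
      also have "\<dots> \<le> ennreal t" using E that by (meson ennreal_leI order_trans)
      finally show ?thesis using less_rearr_iff[OF g, of 0 t] by (simp flip: not_less zero_less_iff_neq_zero)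
    qed
    have "(\<integral>\<^sup>+ t. g t \<partial>M01) = (\<integral>\<^sup>+ t. rearr g t \<partial>M01)"
      by (intro equimeasurable_nn_integral equimeasurable_sym[OF equimeasurable_rearr]) auto
    also have "\<dots> = (\<integral>\<^sup>+ t. rearr g t * indicator {0<..<1 / real n} t \<partial>M01)"
      using zero by (intro nn_integral_cong) (auto simp: space_M01 not_less split: split_indicator)
    finally have "ennreal \<epsilon> < (\<integral>\<^sup>+ t. rearr g t * indicator {0<..<1 / real n} t \<partial>M01)"
      using int by (simp add: g_def)
    then show ?thesis
      using \<open>\<rho> g \<le> 1\<close> n \<epsilon> by (intro ri_norm_indicator_le[OF \<rho> g]) auto
  qed
  then have bd: "\<rho> h \<le> ennreal (2 * (1 / \<epsilon>)) * (\<integral>\<^sup>+ t. h t \<partial>M01)" if "h \<in> borel_measurable M01" for h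
    using that \<epsilon> by (intro ri_norm_le_L1[OF \<rho>]) auto
  obtain C where C: "\<And>f. f \<in> borel_measurable M01 \<Longrightarrow> (\<integral>\<^sup>+ t. f t \<partial>M01) \<le> ennreal C * \<rho> f"
    using ri_norm_L1_bound[OF \<rho>] by metis
  have "\<rho> (\<lambda>t. ennreal \<bar>f t\<bar>) < \<infinity> \<longleftrightarrow> integrable M01 f" if [measurable]: "f \<in> borel_measurable M01" for f
  proof
    assume "\<rho> (\<lambda>t. ennreal \<bar>f t\<bar>) < \<infinity>"
    then have "ennreal C * \<rho> (\<lambda>t. ennreal \<bar>f t\<bar>) < \<infinity>"
      by (simp add: ennreal_mult_less_top)
    then show "integrable M01 f"
      using C[of "\<lambda>t. ennreal \<bar>f t\<bar>"] by (intro integrableI_bounded) auto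
  next
    assume "integrable M01 f"
    then have "(\<integral>\<^sup>+ t. ennreal \<bar>f t\<bar> \<partial>M01) < \<infinity>"
      by (simp add: integrable_iff_bounded)
    then have "ennreal (2 * (1 / \<epsilon>)) * (\<integral>\<^sup>+ t. ennreal \<bar>f t\<bar> \<partial>M01) < \<infinity>"
      by (simp add: ennreal_mult_less_top)
    then show "\<rho> (\<lambda>t. ennreal \<bar>f t\<bar>) < \<infinity>"
      using bd[of "\<lambda>t. ennreal \<bar>f t\<bar>"] by auto
  qed
  then have "ri_space \<rho> = L1_space" by (auto simp: ri_space_def L1_space_def)
  with ne show False ..
qed

subsection \<open>The iterated Hardy operator\<close>

text \<open>The parameter \<open>c\<close> will be the infimum of J(t)/t. It bounds 1/J on every
  [\<delta>,1] with \<delta> > 0, although 1/J need not be integrable near 0.\<close>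

locale iterated_hardy =
  fixes J :: "real \<Rightarrow> real" and j :: nat and c :: real
  assumes J_meas: "J \<in> borel_measurable (lebesgue_on {0<..1})"
    and c_pos: "0 < c"
    and J_ge: "\<And>t. 0 < t \<Longrightarrow> t \<le> 1 \<Longrightarrow> c * t \<le> J t"
    and j_ge: "1 \<le> j"
begin

lemma J_pos: "0 < t \<Longrightarrow> t \<le> 1 \<Longrightarrow> 0 < J t"
  using J_ge[of t] c_pos by (meson less_le_trans mult_pos_pos)

lemma inverse_J_le:
  assumes "0 < \<delta>" "\<delta> \<le> s" "s \<le> 1"
  shows "1 / J s \<le> 1 / (c * \<delta>)"
proof -
  have "c * \<delta> \<le> c * s" using assms c_pos by simp
  also have "\<dots> \<le> J s" using assms by (intro J_ge) auto
  finally have "c * \<delta> \<le> J s" .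
  moreover have "0 < J s" using assms by (intro J_pos) auto
  ultimately show ?thesis using assms c_pos by (intro divide_left_mono) auto
qed

lemma J_measurable_M01 [measurable]: "J \<in> borel_measurable M01"
proof -
  have eq: "M01 = restrict_space (lebesgue_on {0<..1}) {0<..<1}"
    by (simp add: M01_def restrict_restrict_space Int_absorb1 greaterThanLessThan_subseteq_greaterThanAtMost_iff)
  show ?thesis unfolding eq by (rule measurable_restrict_space1[OF J_meas])
qed

lemma inverse_J_measurable_lebesgue:
  "(\<lambda>r. ennreal (1 / J r) * indicator {0<..1} r) \<in> borel_measurable lebesgue"
proof -
  note J_meas [measurable]
  have "(\<lambda>r. ennreal (1 / J r)) \<in> borel_measurable (lebesgue_on {0<..1})" by measurable
  then show ?thesis by (subst (asm) borel_measurable_restrict_space_iff_ennreal) auto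
qed

lemma Jint_finite:
  assumes "0 < t" "s \<le> 1"
  shows "Jint J t s < \<infinity>"
proof -
  have "Jint J t s \<le> (\<integral>\<^sup>+ r. ennreal (1 / (c * t)) * indicator {t..s} r \<partial>lebesgue)"
    unfolding Jint_def
    using assms inverse_J_le[of t] by (intro nn_integral_mono) (auto split: split_indicator intro!: ennreal_leI)
  also have "\<dots> = ennreal (1 / (c * t)) * emeasure lebesgue {t..s}"
    by (rule nn_integral_cmult_indicator) auto
  also have "\<dots> < \<infinity>"
    by (cases "t \<le> s") (auto simp: ennreal_mult_less_top)
  finally show ?thesis .
qed

lemma Jint_split:
  assumes "0 < t" "t \<le> s" "s \<le> 1"
  shows "Jint J t 1 = Jint J t s + Jint J s 1"
proof -
  let ?\<phi> = "\<lambda>r. ennreal (1 / J r) * indicator {0<..1} r"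
  note inverse_J_measurable_lebesgue [measurable]
  have eq: "Jint J x y = (\<integral>\<^sup>+ r. ?\<phi> r * indicator {x..y} r \<partial>lebesgue)" if "0 < x" "y \<le> 1" for x y
    unfolding Jint_def using that by (intro nn_integral_cong) (auto split: split_indicator)
  have "AE r in lebesgue. r \<noteq> s"
    by (intro AE_completion) (rule AE_lborel_singleton)
  then have "(\<integral>\<^sup>+ r. ?\<phi> r * indicator {t..1} r \<partial>lebesgue)
      = (\<integral>\<^sup>+ r. ?\<phi> r * indicator {t..s} r + ?\<phi> r * indicator {s..1} r \<partial>lebesgue)"
  proof (intro nn_integral_cong_AE, eventually_elim)
    fix r :: real assume "r \<noteq> s"
    then show "?\<phi> r * indicator {t..1} r = ?\<phi> r * indicator {t..s} r + ?\<phi> r * indicator {s..1} r"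
      using assms by (auto split: split_indicator)
  qed
  also have "\<dots> = (\<integral>\<^sup>+ r. ?\<phi> r * indicator {t..s} r \<partial>lebesgue) + (\<integral>\<^sup>+ r. ?\<phi> r * indicator {s..1} r \<partial>lebesgue)"
    by (intro nn_integral_add borel_measurable_times_ennreal inverse_J_measurable_lebesgue
        borel_measurable_indicator) auto
  finally show ?thesis using assms eq by simp
qed

section \<open>The kernel of H in terms of the tail integral\<close>

text \<open>The tail integral is finite for \<open>0 < t\<close> by \<open>Jint_finite\<close>.
  Being real, it allows \<open>Jint J t s\<close> to be written as the difference
  \<open>\<Phi> t - \<Phi> s\<close>, whose powers can be expanded.\<close>

definition \<Phi> :: "real \<Rightarrow> real" where "\<Phi> t = enn2real (Jint J t 1)"

lemma \<Phi>_nonneg: "0 \<le> \<Phi> t"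
  by (simp add: \<Phi>_def)

lemma Jint_1_eq: "0 < t \<Longrightarrow> Jint J t 1 = ennreal (\<Phi> t)"
  using Jint_finite[of t 1] by (simp add: \<Phi>_def less_top)

lemma \<Phi>_antimono:
  assumes "0 < t" "t \<le> s" "s \<le> 1"
  shows "\<Phi> s \<le> \<Phi> t"
proof -
  have "ennreal (\<Phi> s) \<le> ennreal (\<Phi> t)"
    using Jint_split[OF assms] assms by (simp flip: Jint_1_eq)
  then show ?thesis by (simp add: \<Phi>_nonneg)
qed

lemma Jint_eq:
  assumes "0 < t" "t \<le> s" "s \<le> 1"
  shows "Jint J t s = ennreal (\<Phi> t - \<Phi> s)"
proof -
  obtain r where r: "Jint J t s = ennreal r" "0 \<le> r"
    using Jint_finite[of t s] assms by (cases "Jint J t s") auto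
  have "ennreal (\<Phi> t) = ennreal (r + \<Phi> s)"
    using Jint_split[OF assms] assms r by (simp add: Jint_1_eq \<Phi>_nonneg ennreal_plus)
  then have "\<Phi> t = r + \<Phi> s"
    using r by (subst (asm) ennreal_inj) (auto simp: \<Phi>_nonneg)
  then show ?thesis using r by simp
qed

lemma \<Phi>_measurable [measurable]: "\<Phi> \<in> borel_measurable M01"
proof -
  have "(\<lambda>t. Jint J t 1) \<in> borel_measurable M01"
    by (rule antimono_on_borel_measurable_M01) (simp add: Jint_1_eq \<Phi>_antimono ennreal_leI)
  then show ?thesis unfolding \<Phi>_def by measurable
qed

lemma \<Phi>_power_le:
  assumes "m \<le> j"
  shows "\<Phi> t ^ m \<le> 1 + \<Phi> t ^ j"
proof (cases "\<Phi> t \<le> 1")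
  case True
  then have "\<Phi> t ^ m \<le> 1" by (intro power_le_one \<Phi>_nonneg)
  moreover have "0 \<le> \<Phi> t ^ j" by (simp add: \<Phi>_nonneg)
  ultimately show ?thesis by linarith
next
  case False
  then have "\<Phi> t ^ m \<le> \<Phi> t ^ j" using assms by (intro power_increasing) auto
  then show ?thesis by simp
qed

text \<open>A single bound on [\<delta>,1) for all weights in use: the first factor bounds 1/J, the
  second bounds every power of \<Phi> with exponent at most \<open>j\<close>.\<close>

definition W :: "real \<Rightarrow> real" where "W \<delta> = 1 / (c * \<delta>) * (1 + \<Phi> \<delta> ^ j)"

lemma W_pos: "0 < \<delta> \<Longrightarrow> 0 < W \<delta>"
  unfolding W_def using c_pos \<Phi>_nonneg[of \<delta>]
  by (intro mult_pos_pos divide_pos_pos) (auto intro: add_pos_nonneg)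

text \<open>The abstract \<open>p\<close> covers both uses: \<open>\<Phi> t - \<Phi> s\<close> in
  the kernel and \<open>\<Phi> s\<close> in the separated weights.\<close>

lemma weight_bound:
  assumes "0 < \<delta>" "\<delta> \<le> s" "s < 1" "m \<le> j" "0 \<le> p" "p \<le> \<Phi> \<delta>"
  shows "0 \<le> 1 / J s * p ^ m" "1 / J s * p ^ m \<le> W \<delta>"
proof -
  have "0 < J s" using assms by (intro J_pos) auto
  then show "0 \<le> 1 / J s * p ^ m" using assms by simp
  have "p ^ m \<le> \<Phi> \<delta> ^ m" using assms by (intro power_mono) auto
  also have "\<dots> \<le> 1 + \<Phi> \<delta> ^ j" using assms by (intro \<Phi>_power_le)
  finally show "1 / J s * p ^ m \<le> W \<delta>"
    unfolding W_def using assms inverse_J_le[of \<delta> s] \<open>0 < J s\<close> c_pos by (intro mult_mono) auto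
qed

text \<open>The lower limit t of the integral defining H is absorbed as an indicator; the upper
  limit 1 is supplied by the measure space.\<close>

definition kern :: "real \<Rightarrow> real \<Rightarrow> real" where
  "kern t s = 1 / fact (j - 1) * (1 / J s * (\<Phi> t - \<Phi> s) ^ (j - 1)) * indicator {t..} s"

lemma kern_measurable [measurable]: "kern t \<in> borel_measurable M01"
proof -
  have "kern t \<in> borel_measurable M01 \<longleftrightarrow>
    (\<lambda>s. 1 / fact (j - 1) * (1 / J s * (\<Phi> t - \<Phi> s) ^ (j - 1)) * indicator {t..} s) \<in> borel_measurable M01"
    by (simp add: kern_def[abs_def])
  also have "\<dots>" by (intro borel_measurable_times indicator_borel_measurable_M01) auto
  finally show ?thesis .
qed

lemma kern_bounds:
  assumes "0 < \<delta>" "\<delta> \<le> t" "0 < s" "s < 1"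
  shows "0 \<le> kern t s" "kern t s \<le> W \<delta>"
proof -
  have "0 \<le> kern t s \<and> kern t s \<le> W \<delta>"
  proof (cases "t \<le> s")
    case True
    have "\<Phi> s \<le> \<Phi> t" "\<Phi> t \<le> \<Phi> \<delta>" using assms True by (auto intro!: \<Phi>_antimono)
    then have w: "0 \<le> 1 / J s * (\<Phi> t - \<Phi> s) ^ (j - 1)" "1 / J s * (\<Phi> t - \<Phi> s) ^ (j - 1) \<le> W \<delta>"
      using weight_bound[of \<delta> s "j - 1" "\<Phi> t - \<Phi> s"] assms True \<Phi>_nonneg[of s] by auto
    have "1 / fact (j - 1) * (1 / J s * (\<Phi> t - \<Phi> s) ^ (j - 1)) \<le> 1 * (1 / J s * (\<Phi> t - \<Phi> s) ^ (j - 1))"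
      using w by (intro mult_right_mono) (auto simp: divide_le_eq_1 fact_ge_1)
    moreover have "0 \<le> 1 / fact (j - 1) * (1 / J s * (\<Phi> t - \<Phi> s) ^ (j - 1))"
      by (rule mult_nonneg_nonneg) (use w(1) in auto)
    ultimately show ?thesis using w True by (simp add: kern_def)
  next
    case False
    then show ?thesis using W_pos[of \<delta>] assms by (simp add: kern_def)
  qed
  then show "0 \<le> kern t s" "kern t s \<le> W \<delta>" by auto
qed

lemma Hop_eq:
  assumes g [measurable]: "g \<in> borel_measurable M01" and t: "0 < t" "t < 1"
  shows "Hop J j g t = (\<integral>\<^sup>+ s. g s * ennreal (kern t s) \<partial>M01)"
proof -
  have "AE s in lebesgue. s \<noteq> (1::real)"
    by (intro AE_completion) (rule AE_lborel_singleton)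
  then have "(\<integral>\<^sup>+ s \<in> {t..1}. g s * ennreal (1 / J s) * (Jint J t s) ^ (j - 1) \<partial>lebesgue)
      = (\<integral>\<^sup>+ s. (g s * ennreal (1 / J s * (\<Phi> t - \<Phi> s) ^ (j - 1)) * indicator {t..} s) * indicator {0<..<1} s \<partial>lebesgue)"
  proof (intro nn_integral_cong_AE, eventually_elim)
    fix s :: real assume "s \<noteq> 1"
    show "g s * ennreal (1 / J s) * (Jint J t s) ^ (j - 1) * indicator {t..1} s
      = (g s * ennreal (1 / J s * (\<Phi> t - \<Phi> s) ^ (j - 1)) * indicator {t..} s) * indicator {0<..<1} s"
    proof (cases "t \<le> s \<and> s < 1")
      case True
      then have "\<Phi> s \<le> \<Phi> t" "0 < J s" using t by (auto intro!: \<Phi>_antimono J_pos)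
      then have "ennreal (1 / J s * (\<Phi> t - \<Phi> s) ^ (j - 1)) = ennreal (1 / J s) * (Jint J t s) ^ (j - 1)"
        using True t by (simp add: Jint_eq ennreal_power ennreal_mult[symmetric] del: times_divide_eq_left)
      then show ?thesis
        using True t by (simp add: mult.assoc)
    next
      case False
      then show ?thesis using \<open>s \<noteq> 1\<close> t by (auto split: split_indicator)
    qed
  qed
  also have "\<dots> = (\<integral>\<^sup>+ s. g s * ennreal (1 / J s * (\<Phi> t - \<Phi> s) ^ (j - 1)) * indicator {t..} s \<partial>M01)"
    by (simp add: nn_integral_M01)
  finally have "Hop J j g t = ennreal (1 / fact (j - 1)) *
      (\<integral>\<^sup>+ s. g s * ennreal (1 / J s * (\<Phi> t - \<Phi> s) ^ (j - 1)) * indicator {t..} s \<partial>M01)"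
    by (simp add: Hop_def)
  also have "\<dots> = (\<integral>\<^sup>+ s. ennreal (1 / fact (j - 1)) *
      (g s * ennreal (1 / J s * (\<Phi> t - \<Phi> s) ^ (j - 1)) * indicator {t..} s) \<partial>M01)"
    by (intro nn_integral_cmult[symmetric] borel_measurable_times indicator_borel_measurable_M01) auto
  also have "\<dots> = (\<integral>\<^sup>+ s. g s * ennreal (kern t s) \<partial>M01)"
  proof (intro nn_integral_cong)
    fix s
    let ?w = "1 / J s * (\<Phi> t - \<Phi> s) ^ (j - 1)"
    have eq: "ennreal (1 / fact (j - 1)) * ennreal ?w = ennreal (1 / fact (j - 1) * ?w)"
      by (rule ennreal_mult'[symmetric]) simp
    show "ennreal (1 / fact (j - 1)) * (g s * ennreal ?w * indicator {t..} s) = g s * ennreal (kern t s)"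
    proof (cases "t \<le> s")
      case True
      then have k: "kern t s = 1 / fact (j - 1) * ?w" and i: "indicator {t..} s = (1::ennreal)"
        by (simp_all add: kern_def)
      show ?thesis unfolding k i
        by (simp only: mult_1_right mult.left_commute[of _ "g s"] eq)
    qed (simp add: kern_def)
  qed
  finally show ?thesis .
qed

text \<open>As t grows, both the domain of integration and \<open>Jint J t s\<close> shrink. No
  measurability of \<open>g\<close> is involved, so \<open>Hop_measurable\<close> holds for every
  \<open>g\<close>.\<close>

lemma Hop_antimono:
  assumes "s \<le> t"
  shows "Hop J j g t \<le> Hop J j g s"
proof -
  have "Jint J t r \<le> Jint J s r" for r
    unfolding Jint_def using assms by (intro nn_integral_mono) (auto split: split_indicator)
  then show ?thesis
    unfolding Hop_def using assms
    by (intro mult_left_mono nn_integral_mono)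
       (auto split: split_indicator intro!: mult_left_mono power_mono)
qed

lemma Hop_measurable [measurable]: "Hop J j g \<in> borel_measurable M01"
  by (rule antimono_on_borel_measurable_M01) (rule Hop_antimono)

lemma Hop_mono:
  assumes "g \<in> borel_measurable M01" "h \<in> borel_measurable M01" "AE s in M01. g s \<le> h s" "0 < t" "t < 1"
  shows "Hop J j g t \<le> Hop J j h t"
proof -
  have "(\<integral>\<^sup>+ s. g s * ennreal (kern t s) \<partial>M01) \<le> (\<integral>\<^sup>+ s. h s * ennreal (kern t s) \<partial>M01)"
    using assms(3) by (intro nn_integral_mono_AE, eventually_elim) (auto intro: mult_right_mono)
  then show ?thesis using assms by (simp add: Hop_eq)
qed

lemma Hop_add:
  assumes [measurable]: "g \<in> borel_measurable M01" "h \<in> borel_measurable M01" and "0 < t" "t < 1"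
  shows "Hop J j (\<lambda>s. g s + h s) t = Hop J j g t + Hop J j h t"
  using assms by (simp add: Hop_eq distrib_right nn_integral_add)

lemma Hop_sum:
  assumes "finite I" "\<And>i. i \<in> I \<Longrightarrow> g i \<in> borel_measurable M01" "0 < t" "t < 1"
  shows "Hop J j (\<lambda>s. \<Sum>i\<in>I. g i s) t = (\<Sum>i\<in>I. Hop J j (g i) t)"
  using assms by (simp add: Hop_eq sum_distrib_right nn_integral_sum)

lemma Hop_scale:
  assumes [measurable]: "g \<in> borel_measurable M01" and "0 < t" "t < 1"
  shows "Hop J j (\<lambda>s. a * g s) t = a * Hop J j g t"
  using assms by (simp add: Hop_eq mult.assoc nn_integral_cmult)

text \<open>Away from 0 the operator is bounded from L^1 to the bounded functions. Hence small mass
  of \<open>g\<close> makes the image small locally uniformly on (0,1).\<close>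

lemma Hop_le:
  assumes [measurable]: "g \<in> borel_measurable M01" and "0 < \<delta>" "\<delta> \<le> t" "t < 1"
  shows "Hop J j g t \<le> ennreal (W \<delta>) * (\<integral>\<^sup>+ s. g s \<partial>M01)"
proof -
  have "Hop J j g t = (\<integral>\<^sup>+ s. g s * ennreal (kern t s) \<partial>M01)"
    using assms by (simp add: Hop_eq)
  also have "\<dots> \<le> (\<integral>\<^sup>+ s. ennreal (W \<delta>) * g s \<partial>M01)"
    using assms kern_bounds
    by (intro nn_integral_mono) (auto simp: space_M01 mult.commute[of "g _"] intro!: mult_right_mono ennreal_leI)
  also have "\<dots> = ennreal (W \<delta>) * (\<integral>\<^sup>+ s. g s \<partial>M01)"
    by (rule nn_integral_cmult) auto
  finally show ?thesis .
qed

section \<open>Separated integrals and the binomial expansion\<close>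

definition wt :: "nat \<Rightarrow> real \<Rightarrow> real" where "wt m s = 1 / J s * \<Phi> s ^ m"

lemma wt_measurable [measurable]: "wt m \<in> borel_measurable M01"
  unfolding wt_def[abs_def] by measurable

lemma wt_nonneg: "0 < s \<Longrightarrow> s < 1 \<Longrightarrow> 0 \<le> wt m s"
  using J_pos[of s] \<Phi>_nonneg[of s] by (simp add: wt_def)

lemma wt_le:
  assumes "0 < \<delta>" "\<delta> \<le> s" "s < 1" "m \<le> j"
  shows "wt m s \<le> W \<delta>"
  unfolding wt_def using assms by (intro weight_bound \<Phi>_nonneg \<Phi>_antimono) auto

text \<open>The weight does not involve the variable t of the operator; the only parameter is the
  lower limit \<open>x\<close>. Subsequences are chosen so that these integrals converge.\<close>

definition G :: "(real \<Rightarrow> real) \<Rightarrow> nat \<Rightarrow> real \<Rightarrow> real" where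
  "G f m x = (\<integral>s. \<bar>f s\<bar> * wt m s * indicator {x..} s \<partial>M01)"

lemma abs_weight_le:
  assumes "0 < \<delta>" "\<delta> \<le> x" "0 < s" "s < 1" "m \<le> j"
  shows "\<bar>f s\<bar> * wt m s * indicator {x..} s \<le> W \<delta> * \<bar>f s\<bar>"
    "0 \<le> \<bar>f s\<bar> * wt m s * indicator {x..} s"
proof -
  have "0 \<le> wt m s" "x \<le> s \<Longrightarrow> wt m s \<le> W \<delta>"
    using assms by (auto intro: wt_nonneg wt_le)
  then show "\<bar>f s\<bar> * wt m s * indicator {x..} s \<le> W \<delta> * \<bar>f s\<bar>"
    "0 \<le> \<bar>f s\<bar> * wt m s * indicator {x..} s"
    using W_pos[of \<delta>] assms
    by (auto split: split_indicator simp: mult.commute[of _ "\<bar>f s\<bar>"] intro!: mult_left_mono mult_nonneg_nonneg)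
qed

lemma G_integrable:
  assumes f: "integrable M01 f" and x: "0 < x" and m: "m \<le> j"
  shows "integrable M01 (\<lambda>s. \<bar>f s\<bar> * wt m s * indicator {x..} s)"
proof (rule Bochner_Integration.integrable_bound)
  show "integrable M01 (\<lambda>s. W x * \<bar>f s\<bar>)" using f by simp
  have [measurable]: "f \<in> borel_measurable M01" using f by auto
  show "(\<lambda>s. \<bar>f s\<bar> * wt m s * indicator {x..} s) \<in> borel_measurable M01"
    by (intro borel_measurable_times indicator_borel_measurable_M01) auto
  show "AE s in M01. norm (\<bar>f s\<bar> * wt m s * indicator {x..} s) \<le> norm (W x * \<bar>f s\<bar>)"
    using abs_weight_le[of x x _ m f] x m W_pos[of x]
    by (intro AE_I2) (simp add: space_M01 abs_of_nonneg del: abs_mult)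
qed

lemma G_bound:
  assumes f: "integrable M01 f" and x: "0 < x" and m: "m \<le> j"
  shows "\<bar>G f m x\<bar> \<le> W x * (\<integral>s. \<bar>f s\<bar> \<partial>M01)"
proof -
  have "0 \<le> G f m x" unfolding G_def
    using abs_weight_le(2)[of x x _ m f] x m by (intro integral_nonneg_AE AE_I2) (auto simp: space_M01)
  moreover have "G f m x \<le> (\<integral>s. W x * \<bar>f s\<bar> \<partial>M01)" unfolding G_def
    using abs_weight_le(1)[of x x _ m f] x m f
    by (intro integral_mono G_integrable) (auto simp: space_M01)
  ultimately show ?thesis by simp
qed

text \<open>Only the strip between \<open>x\<close> and \<open>y\<close> contributes, and there the
  weight is at most \<open>W \<delta>\<close>. Over the unit ball of X the right side is uniformly
  small for short strips, which is equicontinuity.\<close>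

lemma G_diff_bound:
  assumes f: "integrable M01 f" and x: "0 < \<delta>" "\<delta> \<le> x" "x \<le> y" and m: "m \<le> j"
  shows "\<bar>G f m x - G f m y\<bar> \<le> W \<delta> * (\<integral>s. \<bar>f s\<bar> * indicator {x..<y} s \<partial>M01)"
proof -
  have [measurable]: "f \<in> borel_measurable M01" using f by auto
  have int: "integrable M01 (\<lambda>s. \<bar>f s\<bar> * wt m s * indicator {z..} s)" if "0 < z" for z
    using f that m by (rule G_integrable)
  have int2: "integrable M01 (\<lambda>s. \<bar>f s\<bar> * indicator {x..<y} s)"
  proof (rule Bochner_Integration.integrable_bound[OF f])
    show "(\<lambda>s. \<bar>f s\<bar> * indicator {x..<y} s) \<in> borel_measurable M01"
      by (intro borel_measurable_times indicator_borel_measurable_M01) auto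
  qed (auto split: split_indicator)
  have "G f m x - G f m y = (\<integral>s. \<bar>f s\<bar> * wt m s * indicator {x..} s
      - \<bar>f s\<bar> * wt m s * indicator {y..} s \<partial>M01)"
    unfolding G_def using x by (intro Bochner_Integration.integral_diff[symmetric] int) auto
  also have "\<dots> = (\<integral>s. \<bar>f s\<bar> * wt m s * indicator {x..} s * indicator {x..<y} s \<partial>M01)"
    using x by (intro Bochner_Integration.integral_cong refl) (auto split: split_indicator)
  finally have eq: "G f m x - G f m y
      = (\<integral>s. \<bar>f s\<bar> * wt m s * indicator {x..} s * indicator {x..<y} s \<partial>M01)" .
  have "0 \<le> G f m x - G f m y" unfolding eq
    by (intro integral_nonneg_AE AE_I2) (auto simp: space_M01 wt_nonneg split: split_indicator)
  moreover have "G f m x - G f m y \<le> (\<integral>s. W \<delta> * (\<bar>f s\<bar> * indicator {x..<y} s) \<partial>M01)"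
    unfolding eq
  proof (rule integral_mono)
    show "integrable M01 (\<lambda>s. \<bar>f s\<bar> * wt m s * indicator {x..} s * indicator {x..<y} s)"
    proof (rule Bochner_Integration.integrable_bound[OF int[of x]])
      show "(\<lambda>s. \<bar>f s\<bar> * wt m s * indicator {x..} s * indicator {x..<y} s) \<in> borel_measurable M01"
        by (intro borel_measurable_times indicator_borel_measurable_M01) auto
    qed (use x in \<open>auto split: split_indicator\<close>)
    show "integrable M01 (\<lambda>s. W \<delta> * (\<bar>f s\<bar> * indicator {x..<y} s))" using int2 by simp
    show "\<bar>f s\<bar> * wt m s * indicator {x..} s * indicator {x..<y} s
        \<le> W \<delta> * (\<bar>f s\<bar> * indicator {x..<y} s)" if "s \<in> space M01" for s
      using abs_weight_le(1)[of \<delta> x s m f] x m that by (auto simp: space_M01 split: split_indicator)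
  qed
  ultimately show ?thesis by simp
qed

text \<open>The factor of \<open>\<Phi> t ^ i * \<Phi> s ^ (j - 1 - i)\<close> when
  \<open>(\<Phi> t - \<Phi> s) ^ (j - 1) / fact (j - 1)\<close> is expanded.\<close>

definition coef :: "nat \<Rightarrow> real" where
  "coef i = 1 / fact (j - 1) * real ((j - 1) choose i) * (-1) ^ (j - 1 - i)"

text \<open>Expanding \<^term>\<open>(\<Phi> t - \<Phi> s) ^ (j - 1)\<close> by the binomial theorem separates the variables.\<close>

lemma enn2real_Hop_expansion:
  assumes f: "integrable M01 f" and \<delta>: "0 < \<delta>" and t: "0 < t" "t < 1"
  shows "enn2real (Hop J j (\<lambda>s. ennreal \<bar>f s\<bar> * indicator {\<delta>..} s) t)
    = (\<Sum>i\<le>j - 1. coef i * \<Phi> t ^ i * G f (j - 1 - i) (max t \<delta>))"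
proof -
  have [measurable]: "f \<in> borel_measurable M01" using f by auto
  have m: "(\<lambda>s. ennreal \<bar>f s\<bar> * indicator {\<delta>..} s) \<in> borel_measurable M01"
    "(\<lambda>s. \<bar>f s\<bar> * indicator {\<delta>..} s * kern t s) \<in> borel_measurable M01"
    by (auto intro!: borel_measurable_times indicator_borel_measurable_M01)
  have "Hop J j (\<lambda>s. ennreal \<bar>f s\<bar> * indicator {\<delta>..} s) t
      = (\<integral>\<^sup>+ s. ennreal (\<bar>f s\<bar> * indicator {\<delta>..} s * kern t s) \<partial>M01)"
    unfolding Hop_eq[OF m(1) t]
    by (intro nn_integral_cong) (auto simp: ennreal_mult' split: split_indicator)
  moreover have "AE s in M01. 0 \<le> \<bar>f s\<bar> * indicator {\<delta>..} s * kern t s"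
    using kern_bounds(1)[of t t] t by (intro AE_I2) (auto simp: space_M01 split: split_indicator)
  ultimately have "enn2real (Hop J j (\<lambda>s. ennreal \<bar>f s\<bar> * indicator {\<delta>..} s) t)
      = (\<integral>s. \<bar>f s\<bar> * indicator {\<delta>..} s * kern t s \<partial>M01)"
    using m(2) by (simp add: integral_eq_nn_integral)
  also have "\<dots> = (\<integral>s. (\<Sum>i\<le>j - 1. coef i * \<Phi> t ^ i *
      (\<bar>f s\<bar> * wt (j - 1 - i) s * indicator {max t \<delta>..} s)) \<partial>M01)"
  proof (intro Bochner_Integration.integral_cong refl)
    fix s
    have "(\<Phi> t - \<Phi> s) ^ (j - 1) = (\<Phi> t + - \<Phi> s) ^ (j - 1)" by simp
    also have "\<dots> = (\<Sum>i\<le>j - 1. real ((j - 1) choose i) * \<Phi> t ^ i * (- \<Phi> s) ^ (j - 1 - i))"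
      by (rule binomial_ring)
    also have "\<dots> = (\<Sum>i\<le>j - 1. real ((j - 1) choose i) * (-1) ^ (j - 1 - i) * \<Phi> t ^ i * \<Phi> s ^ (j - 1 - i))"
      by (intro sum.cong refl) (simp add: power_minus[of "\<Phi> s"])
    finally have b: "(\<Phi> t - \<Phi> s) ^ (j - 1) = \<dots>" .
    \<comment> \<open>The cutoff at \<delta> and the lower limit t merge into
      \<open>max t \<delta>\<close>. For t below \<delta> the integrals are therefore frozen at
      \<delta>, and t enters only through powers of \<open>\<Phi> t\<close>.\<close>
    have "\<bar>f s\<bar> * indicator {\<delta>..} s * kern t s = \<bar>f s\<bar> * (1 / J s) * indicator {max t \<delta>..} s *
      (1 / fact (j - 1) * (\<Phi> t - \<Phi> s) ^ (j - 1))"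
      by (auto simp: kern_def split: split_indicator)
    also have "\<dots> = (\<Sum>i\<le>j - 1. coef i * \<Phi> t ^ i *
      (\<bar>f s\<bar> * wt (j - 1 - i) s * indicator {max t \<delta>..} s))"
      unfolding b sum_distrib_left coef_def wt_def by (intro sum.cong refl) (simp only: ac_simps)
    finally show "\<bar>f s\<bar> * indicator {\<delta>..} s * kern t s = \<dots>" .
  qed
  also have "\<dots> = (\<Sum>i\<le>j - 1. \<integral>s. coef i * \<Phi> t ^ i *
      (\<bar>f s\<bar> * wt (j - 1 - i) s * indicator {max t \<delta>..} s) \<partial>M01)"
    using f \<delta> by (intro Bochner_Integration.integral_sum integrable_mult_right G_integrable) auto
  also have "\<dots> = (\<Sum>i\<le>j - 1. coef i * \<Phi> t ^ i * G f (j - 1 - i) (max t \<delta>))"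
    unfolding G_def using f \<delta> by (intro sum.cong refl integral_mult_right G_integrable) auto
  finally show ?thesis .
qed

text \<open>Only differences of separated integrals enter, never the size of \<open>f - g\<close>.
  The estimate reaches all t in (0,1) at the price of the weight \<open>1 + \<Phi> t ^ j\<close>,
  which will have finite norm in Y.\<close>

lemma Hop_diff_bound:
  assumes f: "integrable M01 f" "integrable M01 g" and \<delta>: "0 < \<delta>" and t: "0 < t" "t < 1"
    and \<eta>: "\<And>m. m < j \<Longrightarrow> \<bar>G f m (max t \<delta>) - G g m (max t \<delta>)\<bar> \<le> \<eta>"
  shows "\<bar>enn2real (Hop J j (\<lambda>s. ennreal \<bar>f s\<bar> * indicator {\<delta>..} s) t)
      - enn2real (Hop J j (\<lambda>s. ennreal \<bar>g s\<bar> * indicator {\<delta>..} s) t)\<bar>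
    \<le> \<eta> * (\<Sum>i\<le>j - 1. \<bar>coef i\<bar>) * (1 + \<Phi> t ^ j)"
proof -
  \<comment> \<open>The hypothesis at \<open>m = 0\<close>, available because
    \<open>1 \<le> j\<close>, forces \<eta> to be nonnegative.\<close>
  have "0 \<le> \<eta>" using \<eta>[of 0] j_ge by (auto intro: order_trans[OF abs_ge_zero])
  have "\<bar>enn2real (Hop J j (\<lambda>s. ennreal \<bar>f s\<bar> * indicator {\<delta>..} s) t)
      - enn2real (Hop J j (\<lambda>s. ennreal \<bar>g s\<bar> * indicator {\<delta>..} s) t)\<bar>
    = \<bar>\<Sum>i\<le>j - 1. coef i * \<Phi> t ^ i * (G f (j - 1 - i) (max t \<delta>) - G g (j - 1 - i) (max t \<delta>))\<bar>"
    using f \<delta> t by (simp add: enn2real_Hop_expansion sum_subtractf right_diff_distrib)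
  also have "\<dots> \<le> (\<Sum>i\<le>j - 1. \<bar>coef i * \<Phi> t ^ i * (G f (j - 1 - i) (max t \<delta>) - G g (j - 1 - i) (max t \<delta>))\<bar>)"
    by (rule sum_abs)
  also have "\<dots> \<le> (\<Sum>i\<le>j - 1. \<bar>coef i\<bar> * (1 + \<Phi> t ^ j) * \<eta>)"
  proof (rule sum_mono)
    fix i assume i: "i \<in> {..j - 1}"
    have "\<bar>\<Phi> t ^ i\<bar> \<le> 1 + \<Phi> t ^ j" using i j_ge \<Phi>_power_le[of i t] \<Phi>_nonneg[of t] by auto
    moreover have "\<bar>G f (j - 1 - i) (max t \<delta>) - G g (j - 1 - i) (max t \<delta>)\<bar> \<le> \<eta>"
      using j_ge by (intro \<eta>) auto
    ultimately show "\<bar>coef i * \<Phi> t ^ i * (G f (j - 1 - i) (max t \<delta>) - G g (j - 1 - i) (max t \<delta>))\<bar>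
      \<le> \<bar>coef i\<bar> * (1 + \<Phi> t ^ j) * \<eta>"
      unfolding abs_mult using \<Phi>_nonneg[of t] by (intro mult_mono) auto
  qed
  also have "\<dots> = \<eta> * (\<Sum>i\<le>j - 1. \<bar>coef i\<bar>) * (1 + \<Phi> t ^ j)"
    by (simp add: sum_distrib_left sum_distrib_right ac_simps)
  finally show ?thesis .
qed

end

subsection \<open>The equivalences\<close>

text \<open>Non-strict bounds by real numbers are the form that passes through suprema.\<close>

lemma ennreal_tendsto_0_iff_le:
  fixes x :: "'a \<Rightarrow> ennreal"
  shows "(x \<longlongrightarrow> 0) F \<longleftrightarrow> (\<forall>e>0. \<forall>\<^sub>F n in F. x n \<le> ennreal e)"
proof
  assume lim: "(x \<longlongrightarrow> 0) F"
  show "\<forall>e>0. \<forall>\<^sub>F n in F. x n \<le> ennreal e"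
  proof (intro allI impI)
    fix e :: real assume "0 < e"
    then have "0 < ennreal e" by simp
    from order_tendstoD(2)[OF lim this] show "\<forall>\<^sub>F n in F. x n \<le> ennreal e"
      by eventually_elim simp
  qed
next
  assume *: "\<forall>e>0. \<forall>\<^sub>F n in F. x n \<le> ennreal e"
  show "(x \<longlongrightarrow> 0) F"
  proof (rule order_tendstoI)
    fix a :: ennreal assume "0 < a"
    then obtain b where "0 < b" "b < a" using dense by blast
    then obtain e where e: "b = ennreal e" "0 < e" by (cases b) auto
    with * have "\<forall>\<^sub>F n in F. x n \<le> b" by simp
    then show "\<forall>\<^sub>F n in F. x n < a"
      by eventually_elim (use \<open>b < a\<close> in simp)
  qed simp
qed

lemma ennreal_tendsto_0_at_right_iff:
  fixes \<phi> :: "real \<Rightarrow> ennreal"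
  shows "(\<phi> \<longlongrightarrow> 0) (at_right 0) \<longleftrightarrow> (\<forall>e>0. \<exists>b>0. \<forall>a. 0 < a \<longrightarrow> a < b \<longrightarrow> \<phi> a \<le> ennreal e)"
  unfolding ennreal_tendsto_0_iff_le eventually_at_right_field by blast

lemma exists_small_factor:
  fixes z e :: real
  assumes "0 \<le> z" "0 < e"
  obtains \<eta> where "0 < \<eta>" "\<eta> * z < e"
proof (rule that[of "e / (z + 1)"])
  show "0 < e / (z + 1)" using assms by simp
  have "e * z < e * (z + 1)" using assms by simp
  then show "e / (z + 1) * z < e" using assms by (simp add: divide_less_eq)
qed

section \<open>Conditions (ii) and (iii)\<close>

locale hardy_pair = iterated_hardy +
  fixes \<rho>X \<rho>Y :: "(real \<Rightarrow> ennreal) \<Rightarrow> ennreal"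
  assumes X: "ri_norm \<rho>X" and XL1: "ri_space \<rho>X \<noteq> L1_space"
    and Y: "ri_norm \<rho>Y" and Yfin: "\<rho>Y (\<lambda>t. (Jint J t 1) ^ j) < \<infinity>"
begin

text \<open>Condition (ii) with its limit and suprema unfolded; (i) and (iii) are each compared with
  this form.\<close>

definition uniformly_small :: bool where
  "uniformly_small \<longleftrightarrow> (\<forall>e>0. \<exists>a>0. \<forall>f E. f \<in> borel_measurable M01 \<longrightarrow> \<rho>X (\<lambda>t. ennreal \<bar>f t\<bar>) \<le> 1 \<longrightarrow>
     E \<in> sets M01 \<longrightarrow> emeasure M01 E \<le> ennreal a \<longrightarrow>
     \<rho>Y (Hop J j (\<lambda>s. ennreal \<bar>indicator E s * f s\<bar>)) \<le> ennreal e)"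

text \<open>A bound valid for one \<open>a\<close> is inherited by all smaller ones, so a bound for
  all small \<open>a\<close> amounts to a bound for a single \<open>a\<close>.\<close>

lemma tendsto_iff_uniformly_small:
  "((\<lambda>a::real. SUP f \<in> {f \<in> borel_measurable M01. \<rho>X (\<lambda>t. ennreal \<bar>f t\<bar>) \<le> 1}.
       SUP E \<in> {E \<in> sets M01. emeasure M01 E \<le> ennreal a}.
         \<rho>Y (Hop J j (\<lambda>s. ennreal \<bar>indicator E s * f s\<bar>))) \<longlongrightarrow> 0) (at_right 0) \<longleftrightarrow> uniformly_small"
  (is "(?\<phi> \<longlongrightarrow> 0) _ \<longleftrightarrow> _")
proof -
  let ?P = "\<lambda>a e. \<forall>f E. f \<in> borel_measurable M01 \<longrightarrow> \<rho>X (\<lambda>t. ennreal \<bar>f t\<bar>) \<le> 1 \<longrightarrow>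
     E \<in> sets M01 \<longrightarrow> emeasure M01 E \<le> ennreal a \<longrightarrow>
     \<rho>Y (Hop J j (\<lambda>s. ennreal \<bar>indicator E s * f s\<bar>)) \<le> ennreal e"
  have eq: "?\<phi> a \<le> ennreal e \<longleftrightarrow> ?P a e" for a e
    by (auto simp: SUP_le_iff)
  have mono: "?P a e" if "?P b e" "a \<le> b" for a b e
    using that by (meson ennreal_leI order_trans)
  have "(\<exists>b>0. \<forall>a. 0 < a \<longrightarrow> a < b \<longrightarrow> ?P a e) \<longleftrightarrow> (\<exists>a>0. ?P a e)" for e
  proof
    assume "\<exists>b>0. \<forall>a. 0 < a \<longrightarrow> a < b \<longrightarrow> ?P a e"
    then obtain b where "0 < b" and b: "\<And>a. 0 < a \<Longrightarrow> a < b \<Longrightarrow> ?P a e" by blast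
    then show "\<exists>a>0. ?P a e" using b[of "b / 2"] by (intro exI[of _ "b / 2"]) simp
  next
    assume "\<exists>a>0. ?P a e"
    then obtain b where "0 < b" "?P b e" by blast
    then show "\<exists>b>0. \<forall>a. 0 < a \<longrightarrow> a < b \<longrightarrow> ?P a e"
      using mono less_imp_le by blast
  qed
  then show ?thesis
    unfolding ennreal_tendsto_0_at_right_iff uniformly_small_def eq by simp
qed

text \<open>For \<open>E\<close> of measure at most \<open>a\<close>, the product \<open>g\<close>
  of \<open>f\<close> with the indicator of \<open>E\<close> has \<open>rearr g\<close> carried by
  (0,a). So |g| itself competes in the supremum defining the \<open>Yd\<close> norm of the truncated
  rearrangement of \<open>g\<close>.\<close>

lemma uniformly_small_if_almost_compact:
  assumes "almost_compact \<rho>X (Yd J j \<rho>Y)"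
  shows uniformly_small
  unfolding uniformly_small_def
proof (intro allI impI)
  fix e :: real assume "0 < e"
  let ?Y = "\<lambda>a f. Yd J j \<rho>Y (\<lambda>t. indicator {0<..<a} t * rearr (\<lambda>s. ennreal \<bar>f s\<bar>) t)"
  obtain b where b: "0 < b" "\<And>a. 0 < a \<Longrightarrow> a < b \<Longrightarrow>
      (SUP f \<in> {f \<in> borel_measurable M01. \<rho>X (\<lambda>t. ennreal \<bar>f t\<bar>) \<le> 1}. ?Y a f) \<le> ennreal e"
    using assms \<open>0 < e\<close> unfolding almost_compact_def ennreal_tendsto_0_at_right_iff by blast
  define a where "a = b / 2"
  have a: "0 < a" "a < b" using b by (auto simp: a_def)
  show "\<exists>a>0. \<forall>f E. f \<in> borel_measurable M01 \<longrightarrow> \<rho>X (\<lambda>t. ennreal \<bar>f t\<bar>) \<le> 1 \<longrightarrow>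
     E \<in> sets M01 \<longrightarrow> emeasure M01 E \<le> ennreal a \<longrightarrow>
     \<rho>Y (Hop J j (\<lambda>s. ennreal \<bar>indicator E s * f s\<bar>)) \<le> ennreal e"
  proof (intro exI[of _ a] conjI allI impI a)
    fix f E assume [measurable]: "f \<in> borel_measurable M01" and f: "\<rho>X (\<lambda>t. ennreal \<bar>f t\<bar>) \<le> 1"
      and [measurable]: "E \<in> sets M01" and E: "emeasure M01 E \<le> ennreal a"
    define g where "g s = indicator E s * f s" for s
    have [measurable]: "g \<in> borel_measurable M01" unfolding g_def by measurable
    let ?g = "\<lambda>s. ennreal \<bar>g s\<bar>"
    have gm: "?g \<in> borel_measurable M01" by measurable
    have "\<rho>X ?g \<le> \<rho>X (\<lambda>t. ennreal \<bar>f t\<bar>)"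
      by (intro ri_norm_mono[OF X]) (auto simp: g_def split: split_indicator)
    then have g1: "\<rho>X ?g \<le> 1" using f by simp
    have "indicator {0<..<a} t * rearr ?g t = rearr ?g t" if "0 < t" for t
    proof (cases "t < a")
      case False
      have "emeasure M01 {s \<in> space M01. 0 < ?g s} \<le> emeasure M01 E"
        by (intro emeasure_mono) (auto simp: g_def split: split_indicator_asm)
      also have "\<dots> \<le> ennreal t" using E False by (meson ennreal_leI not_less order_trans)
      finally have "\<not> 0 < rearr ?g t" using less_rearr_iff[OF gm, of 0 t] by (simp add: not_less)
      then have "rearr ?g t = 0" by (simp add: zero_less_iff_neq_zero)
      then show ?thesis by simp
    qed (use that in simp)
    then have "equimeasurable ?g (\<lambda>t. indicator {0<..<a} t * rearr ?g t)"
      using equimeasurable_sym[OF equimeasurable_rearr[OF gm]]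
      by (subst equimeasurable_cong[where h = "rearr ?g"]) auto
    then have "\<rho>Y (Hop J j ?g) \<le> (SUP h \<in> {h \<in> borel_measurable M01.
        equimeasurable h (\<lambda>t. indicator {0<..<a} t * rearr ?g t)}. \<rho>Y (Hop J j h))"
      using gm by (intro SUP_upper) blast
    also have "\<dots> \<le> ?Y a g" unfolding Yd_def by simp
    also have "\<dots> \<le> (SUP f \<in> {f \<in> borel_measurable M01. \<rho>X (\<lambda>t. ennreal \<bar>f t\<bar>) \<le> 1}. ?Y a f)"
      using g1 by (intro SUP_upper) auto
    also have "\<dots> \<le> ennreal e" using a by (rule b)
    finally show "\<rho>Y (Hop J j (\<lambda>s. ennreal \<bar>indicator E s * f s\<bar>)) \<le> ennreal e"
      by (simp add: g_def)
  qed
qed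

text \<open>Any \<open>h\<close> equimeasurable with the rearrangement truncated to (0,a) has norm
  at most 1 and a support of measure at most \<open>a\<close>, so (ii) applies with that support as
  \<open>E\<close>. Half of \<open>e\<close> is reserved for the L^1 term.\<close>

lemma almost_compact_if_uniformly_small:
  assumes uniformly_small
  shows "almost_compact \<rho>X (Yd J j \<rho>Y)"
  unfolding almost_compact_def ennreal_tendsto_0_at_right_iff
proof (intro allI impI)
  fix e :: real assume "0 < e"
  then have e2: "0 < e / 2" by simp
  obtain a1 where a1: "0 < a1" "\<And>f E. f \<in> borel_measurable M01 \<Longrightarrow> \<rho>X (\<lambda>t. ennreal \<bar>f t\<bar>) \<le> 1 \<Longrightarrow>
     E \<in> sets M01 \<Longrightarrow> emeasure M01 E \<le> ennreal a1 \<Longrightarrow>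
     \<rho>Y (Hop J j (\<lambda>s. ennreal \<bar>indicator E s * f s\<bar>)) \<le> ennreal (e / 2)"
    using assms e2 unfolding uniformly_small_def by blast
  obtain a2 where a2: "0 < a2" "\<And>f E. f \<in> borel_measurable M01 \<Longrightarrow> \<rho>X f \<le> 1 \<Longrightarrow> E \<in> sets M01 \<Longrightarrow>
    emeasure M01 E \<le> ennreal a2 \<Longrightarrow> (\<integral>\<^sup>+ t. f t * indicator E t \<partial>M01) \<le> ennreal (e / 2)"
    using ri_ball_uniformly_integrable[OF X XL1 e2] by blast
  obtain C where C: "\<And>f. f \<in> borel_measurable M01 \<Longrightarrow> (\<integral>\<^sup>+ t. f t \<partial>M01) \<le> ennreal C * \<rho>X f"
    using ri_norm_L1_bound[OF X] by metis
  define b where "b = min 1 (min a1 a2)"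
  have "Yd J j \<rho>Y (\<lambda>t. indicator {0<..<a} t * rearr (\<lambda>s. ennreal \<bar>f s\<bar>) t) \<le> ennreal e"
    if a: "0 < a" "a < b" and [measurable]: "f \<in> borel_measurable M01"
      and f: "\<rho>X (\<lambda>t. ennreal \<bar>f t\<bar>) \<le> 1" for a f
  proof -
    let ?f = "\<lambda>s. ennreal \<bar>f s\<bar>"
    let ?g = "\<lambda>t. indicator {0<..<a} t * rearr ?f t"
    have ab: "a \<le> 1" "a \<le> a1" "a \<le> a2" using a by (auto simp: b_def)
    have sa: "{0<..<a} \<in> sets M01" using ab by (auto simp: sets_M01)
    have ma: "emeasure M01 {0<..<a} = ennreal a" using a ab by (intro emeasure_M01_Ioo) auto
    have gm: "?g \<in> borel_measurable M01"
      by (intro borel_measurable_times_ennreal indicator_borel_measurable_M01) auto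
    have rX: "\<rho>X (rearr ?f) = \<rho>X ?f"
      by (intro ri_norm_equimeasurable[OF X] equimeasurable_rearr) auto
    have "(\<integral>\<^sup>+ t. rearr ?f t * indicator {0<..<a} t \<partial>M01) \<le> ennreal (e / 2)"
      using ab f sa by (intro a2) (auto simp: rX ma intro: ennreal_leI)
    then have int: "(\<integral>\<^sup>+ t. ?g t \<partial>M01) \<le> ennreal (e / 2)" by (simp add: mult.commute)
    have gX: "\<rho>X ?g \<le> 1"
    proof -
      have "\<rho>X ?g \<le> \<rho>X (rearr ?f)"
        using gm by (intro ri_norm_mono[OF X]) (auto split: split_indicator)
      with f rX show ?thesis by simp
    qed
    have "\<rho>Y (Hop J j h) \<le> ennreal (e / 2)"
      if hm [measurable]: "h \<in> borel_measurable M01" and h: "equimeasurable h ?g" for h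
    proof -
      have hX: "\<rho>X h \<le> 1" using ri_norm_equimeasurable[OF X hm gm h] gX by simp
      have "(\<integral>\<^sup>+ t. h t \<partial>M01) \<le> ennreal C * 1"
        using C[OF hm] mult_left_mono[OF hX, of "ennreal C"] by (simp add: order_trans)
      then have "(\<integral>\<^sup>+ t. h t \<partial>M01) \<noteq> \<infinity>" by (auto simp: top_unique)
      \<comment> \<open>Condition (ii) concerns real functions, so \<open>h\<close> must be finite
        almost everywhere before it is replaced by \<open>enn2real\<close> of its values.\<close>
      then have fin: "AE s in M01. h s \<noteq> \<infinity>" by (intro nn_integral_noteq_infinite) auto
      define E where "E = {s \<in> space M01. 0 < h s}"
      have [measurable]: "E \<in> sets M01" unfolding E_def by measurable
      have "emeasure M01 E = emeasure M01 {s \<in> space M01. 0 < ?g s}"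
        using h unfolding E_def equimeasurable_def by blast
      also have "\<dots> \<le> emeasure M01 {0<..<a}"
        using sa by (intro emeasure_mono) (auto split: split_indicator_asm)
      finally have E: "emeasure M01 E \<le> ennreal a1" using ma ab by (simp add: ennreal_leI order_trans)
      let ?h = "\<lambda>s. ennreal \<bar>indicator E s * enn2real (h s)\<bar>"
      have "AE s in M01. s \<in> space M01" by (rule AE_space)
      with fin have eq: "AE s in M01. h s = ?h s"
        by eventually_elim (auto simp: E_def less_top zero_less_iff_neq_zero split: split_indicator)
      have "AE s in M01. ennreal \<bar>enn2real (h s)\<bar> = h s"
        using fin by eventually_elim (simp add: less_top)
      then have "\<rho>X (\<lambda>s. ennreal \<bar>enn2real (h s)\<bar>) = \<rho>X h"
        by (intro ri_norm_cong_AE[OF X]) auto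
      then have "\<rho>Y (Hop J j ?h) \<le> ennreal (e / 2)"
        using hX E by (intro a1) auto
      moreover have "\<rho>Y (Hop J j h) \<le> \<rho>Y (Hop J j ?h)"
      proof (intro ri_norm_mono[OF Y] Hop_measurable Hop_mono)
        show "AE s in M01. h s \<le> ?h s" using eq by eventually_elim simp
      qed auto
      ultimately show ?thesis by simp
    qed
    then have "Yd J j \<rho>Y ?g \<le> ennreal (e / 2) + ennreal (e / 2)"
      unfolding Yd_def using int by (intro add_mono SUP_least) auto
    also have "\<dots> = ennreal e" using e2 by (simp add: ennreal_plus[symmetric])
    finally show ?thesis .
  qed
  moreover have "0 < b" using a1 a2 by (simp add: b_def)
  ultimately show "\<exists>b>0. \<forall>a. 0 < a \<longrightarrow> a < b \<longrightarrow>
      (SUP f \<in> {f \<in> borel_measurable M01. \<rho>X (\<lambda>t. ennreal \<bar>f t\<bar>) \<le> 1}.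
        Yd J j \<rho>Y (\<lambda>t. indicator {0<..<a} t * rearr (\<lambda>s. ennreal \<bar>f s\<bar>) t)) \<le> ennreal e"
    by (intro exI[of _ b] conjI allI impI SUP_least) auto
qed

section \<open>From (i) to (ii)\<close>

text \<open>Counterexamples to (ii) on sets of measure at most 1/(n+1) have images of norm above
  \<open>e\<close> in Y that tend to 0 locally uniformly. A norm limit of a subsequence must vanish,
  which contradicts the lower bound.\<close>

lemma uniformly_small_if_compact:
  assumes comp: "compact_op \<rho>X \<rho>Y (\<lambda>f. Hop J j (\<lambda>s. ennreal \<bar>f s\<bar>))"
  shows uniformly_small
proof (rule ccontr)
  assume "\<not> uniformly_small"
  then obtain e where "0 < e" and neg: "\<And>a. 0 < a \<Longrightarrow> \<exists>f E. f \<in> borel_measurable M01 \<and>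
     \<rho>X (\<lambda>t. ennreal \<bar>f t\<bar>) \<le> 1 \<and> E \<in> sets M01 \<and> emeasure M01 E \<le> ennreal a \<and>
     ennreal e < \<rho>Y (Hop J j (\<lambda>s. ennreal \<bar>indicator E s * f s\<bar>))"
    unfolding uniformly_small_def by (meson not_less)
  have "\<forall>n. \<exists>f E. f \<in> borel_measurable M01 \<and>
     \<rho>X (\<lambda>t. ennreal \<bar>f t\<bar>) \<le> 1 \<and> E \<in> sets M01 \<and> emeasure M01 E \<le> ennreal (1 / real (Suc n)) \<and>
     ennreal e < \<rho>Y (Hop J j (\<lambda>s. ennreal \<bar>indicator E s * f s\<bar>))"
    by (intro allI neg) simp
  from choice[OF this] obtain f where "\<forall>n. \<exists>E. f n \<in> borel_measurable M01 \<and>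
     \<rho>X (\<lambda>t. ennreal \<bar>f n t\<bar>) \<le> 1 \<and> E \<in> sets M01 \<and> emeasure M01 E \<le> ennreal (1 / real (Suc n)) \<and>
     ennreal e < \<rho>Y (Hop J j (\<lambda>s. ennreal \<bar>indicator E s * f n s\<bar>))" ..
  from choice[OF this] obtain E where fm [measurable]: "\<And>n. f n \<in> borel_measurable M01"
    and f: "\<And>n. \<rho>X (\<lambda>t. ennreal \<bar>f n t\<bar>) \<le> 1"
    and Em [measurable]: "\<And>n. E n \<in> sets M01" and E: "\<And>n. emeasure M01 (E n) \<le> ennreal (1 / real (Suc n))"
    and large: "\<And>n. ennreal e < \<rho>Y (Hop J j (\<lambda>s. ennreal \<bar>indicator (E n) s * f n s\<bar>))"
    by blast
  define g where "g n s = indicator (E n) s * f n s" for n s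
  have gm [measurable]: "g n \<in> borel_measurable M01" for n unfolding g_def by measurable
  define U where "U n = Hop J j (\<lambda>s. ennreal \<bar>g n s\<bar>)" for n
  have Um [measurable]: "U n \<in> borel_measurable M01" for n unfolding U_def by measurable
  have "\<rho>X (\<lambda>t. ennreal \<bar>g n t\<bar>) \<le> ennreal 1" for n
  proof -
    have "\<rho>X (\<lambda>t. ennreal \<bar>g n t\<bar>) \<le> \<rho>X (\<lambda>t. ennreal \<bar>f n t\<bar>)"
      by (intro ri_norm_mono[OF X]) (auto simp: g_def split: split_indicator)
    with f[of n] show ?thesis by simp
  qed
  with gm comp obtain r u where r: "strict_mono r" and u: "u \<in> ri_space \<rho>Y"
    and lim: "(\<lambda>n. \<rho>Y (\<lambda>t. ennreal \<bar>enn2real (U (r n) t) - u t\<bar>)) \<longlonglongrightarrow> 0"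
    unfolding compact_op_def U_def by blast
  have [measurable]: "u \<in> borel_measurable M01" using u by (simp add: ri_space_def)
  have gint: "(\<lambda>n. \<integral>\<^sup>+ s. ennreal \<bar>g n s\<bar> \<partial>M01) \<longlonglongrightarrow> 0"
    unfolding ennreal_tendsto_0_iff_le
  proof (intro allI impI)
    fix \<epsilon> :: real assume "0 < \<epsilon>"
    then obtain a where a: "0 < a" "\<And>f E. f \<in> borel_measurable M01 \<Longrightarrow> \<rho>X f \<le> 1 \<Longrightarrow> E \<in> sets M01 \<Longrightarrow>
      emeasure M01 E \<le> ennreal a \<Longrightarrow> (\<integral>\<^sup>+ t. f t * indicator E t \<partial>M01) \<le> ennreal \<epsilon>"
      using ri_ball_uniformly_integrable[OF X XL1 \<open>0 < \<epsilon>\<close>] by blast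
    have "(\<lambda>n. 1 / real (Suc n)) \<longlonglongrightarrow> 0" by (intro LIMSEQ_Suc lim_1_over_n)
    from order_tendstoD(2)[OF this a(1)]
    show "\<forall>\<^sub>F n in sequentially. (\<integral>\<^sup>+ s. ennreal \<bar>g n s\<bar> \<partial>M01) \<le> ennreal \<epsilon>"
    proof eventually_elim
      fix n assume "1 / real (Suc n) < a"
      then have "emeasure M01 (E n) \<le> ennreal a" using E[of n] by (meson ennreal_leI less_imp_le order_trans)
      then have "(\<integral>\<^sup>+ s. ennreal \<bar>f n s\<bar> * indicator (E n) s \<partial>M01) \<le> ennreal \<epsilon>"
        using f by (intro a) auto
      moreover have "ennreal \<bar>f n s\<bar> * indicator (E n) s = ennreal \<bar>g n s\<bar>" for s
        by (simp add: g_def split: split_indicator)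
      ultimately show "(\<integral>\<^sup>+ s. ennreal \<bar>g n s\<bar> \<partial>M01) \<le> ennreal \<epsilon>" by simp
    qed
  qed
  have gfin: "(\<integral>\<^sup>+ s. ennreal \<bar>g n s\<bar> \<partial>M01) < \<infinity>" for n
  proof -
    obtain C where "0 < C" "\<And>f. f \<in> borel_measurable M01 \<Longrightarrow> (\<integral>\<^sup>+ t. f t \<partial>M01) \<le> ennreal C * \<rho>X f"
      using ri_norm_L1_bound[OF X] by metis
    then have "(\<integral>\<^sup>+ s. ennreal \<bar>g n s\<bar> \<partial>M01) \<le> ennreal C * \<rho>X (\<lambda>s. ennreal \<bar>g n s\<bar>)" by simp
    also have "\<dots> \<le> ennreal C * ennreal 1"
      using \<open>\<And>n. \<rho>X (\<lambda>t. ennreal \<bar>g n t\<bar>) \<le> ennreal 1\<close> by (intro mult_left_mono) auto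
    also have "\<dots> < \<infinity>" by simp
    finally show ?thesis .
  qed
  \<comment> \<open>\<open>compact_op\<close> sees the images through \<open>enn2real\<close>;
    pointwise finiteness ensures that this loses nothing.\<close>
  have Ufin: "U n t < \<infinity>" if "0 < t" "t < 1" for n t
  proof -
    have "U n t \<le> ennreal (W t) * (\<integral>\<^sup>+ s. ennreal \<bar>g n s\<bar> \<partial>M01)"
      unfolding U_def using that by (intro Hop_le) auto
    also have "\<dots> < \<infinity>" using gfin[of n] by (simp add: ennreal_mult_less_top)
    finally show ?thesis .
  qed
  obtain C where C: "\<And>f. f \<in> borel_measurable M01 \<Longrightarrow> (\<integral>\<^sup>+ t. f t \<partial>M01) \<le> ennreal C * \<rho>Y f"
    using ri_norm_L1_bound[OF Y] by metis
  \<comment> \<open>On [\<delta>,1), |u| is at most |U - u| + U. The first term has integral bounded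
    by its norm in Y, the second is bounded by \<open>W \<delta>\<close> times the mass of
    \<open>g (r n)\<close>, and both bounds tend to 0.\<close>
  have zero: "AE t in M01. ennreal \<bar>u t\<bar> * indicator {\<delta>..} t = 0" if \<delta>: "0 < \<delta>" for \<delta>
  proof -
    let ?x = "\<lambda>n. ennreal C * \<rho>Y (\<lambda>t. ennreal \<bar>enn2real (U (r n) t) - u t\<bar>)
      + ennreal (W \<delta>) * (\<integral>\<^sup>+ s. ennreal \<bar>g (r n) s\<bar> \<partial>M01)"
    have m: "(\<lambda>t. ennreal \<bar>u t\<bar> * indicator {\<delta>..} t) \<in> borel_measurable M01"
      by (intro borel_measurable_times_ennreal indicator_borel_measurable_M01) auto
    have "(\<integral>\<^sup>+ t. ennreal \<bar>u t\<bar> * indicator {\<delta>..} t \<partial>M01) \<le> ?x n" for n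
    proof -
      let ?w = "ennreal (W \<delta>) * (\<integral>\<^sup>+ s. ennreal \<bar>g (r n) s\<bar> \<partial>M01)"
      have "(\<integral>\<^sup>+ t. ennreal \<bar>u t\<bar> * indicator {\<delta>..} t \<partial>M01)
        \<le> (\<integral>\<^sup>+ t. ennreal \<bar>enn2real (U (r n) t) - u t\<bar> + ?w \<partial>M01)"
      proof (rule nn_integral_mono)
        fix t assume "t \<in> space M01"
        then have t: "0 < t" "t < 1" by (auto simp: space_M01)
        show "ennreal \<bar>u t\<bar> * indicator {\<delta>..} t \<le> ennreal \<bar>enn2real (U (r n) t) - u t\<bar> + ?w"
        proof (cases "\<delta> \<le> t")
          case True
          have "ennreal \<bar>u t\<bar> \<le> ennreal (\<bar>enn2real (U (r n) t) - u t\<bar> + enn2real (U (r n) t))"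
            using enn2real_nonneg[of "U (r n) t"] by (intro ennreal_leI) linarith
          also have "\<dots> = ennreal \<bar>enn2real (U (r n) t) - u t\<bar> + U (r n) t"
            using Ufin[OF t, of "r n"] by (simp add: ennreal_plus less_top)
          also have "\<dots> \<le> ennreal \<bar>enn2real (U (r n) t) - u t\<bar> + ?w"
            unfolding U_def using True t \<delta> by (intro add_left_mono Hop_le) auto
          finally show ?thesis using True by simp
        qed simp
      qed
      also have "\<dots> = (\<integral>\<^sup>+ t. ennreal \<bar>enn2real (U (r n) t) - u t\<bar> \<partial>M01) + ?w * emeasure M01 (space M01)"
        by (subst nn_integral_add) auto
      also have "\<dots> \<le> ?x n"
        using mult_left_mono[OF emeasure_M01_le_1[of "space M01"], of ?w] by (intro add_mono C) simp_all
      finally show ?thesis .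
    qed
    moreover have "?x \<longlonglongrightarrow> ennreal C * 0 + ennreal (W \<delta>) * 0"
      using LIMSEQ_subseq_LIMSEQ[OF gint r]
      by (intro tendsto_add ennreal_tendsto_cmult lim) (auto simp: o_def)
    ultimately have "(\<integral>\<^sup>+ t. ennreal \<bar>u t\<bar> * indicator {\<delta>..} t \<partial>M01) \<le> ennreal C * 0 + ennreal (W \<delta>) * 0"
      by (intro LIMSEQ_le_const) auto
    then have "(\<integral>\<^sup>+ t. ennreal \<bar>u t\<bar> * indicator {\<delta>..} t \<partial>M01) = 0" by simp
    then show ?thesis using m by (subst (asm) nn_integral_0_iff_AE) auto
  qed
  have "AE t in M01. \<forall>k::nat. ennreal \<bar>u t\<bar> * indicator {1 / real (Suc k)..} t = 0"
    unfolding AE_all_countable by (intro allI zero) simp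
  moreover have "AE t in M01. t \<in> space M01" by (rule AE_space)
  ultimately have "AE t in M01. ennreal \<bar>enn2real (U (r n) t) - u t\<bar> = U (r n) t" for n
  proof eventually_elim
    fix t assume *: "\<forall>k::nat. ennreal \<bar>u t\<bar> * indicator {1 / real (Suc k)..} t = 0" and "t \<in> space M01"
    then have t: "0 < t" "t < 1" by (auto simp: space_M01)
    then obtain k where "1 / real (Suc k) < t" using reals_Archimedean[of t] by (auto simp: field_simps)
    with * have "u t = 0" by (auto split: split_indicator_asm dest!: spec[of _ k])
    then show "ennreal \<bar>enn2real (U (r n) t) - u t\<bar> = U (r n) t"
      using Ufin[OF t, of "r n"] by (simp add: less_top)
  qed
  then have "\<rho>Y (\<lambda>t. ennreal \<bar>enn2real (U (r n) t) - u t\<bar>) = \<rho>Y (U (r n))" for n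
    by (intro ri_norm_cong_AE[OF Y]) auto
  with lim have "(\<lambda>n. \<rho>Y (U (r n))) \<longlonglongrightarrow> 0" by simp
  then have "\<forall>\<^sub>F n in sequentially. \<rho>Y (U (r n)) \<le> ennreal e"
    using \<open>0 < e\<close> unfolding ennreal_tendsto_0_iff_le by blast
  then obtain n where "\<rho>Y (U (r n)) \<le> ennreal e"
    by (auto simp: eventually_sequentially)
  with large[of "r n"] show False by (simp add: U_def g_def)
qed

section \<open>From (ii) to (i)\<close>

lemma integral_le_on_ball:
  obtains L where "0 < L" "\<And>f. f \<in> borel_measurable M01 \<Longrightarrow> \<rho>X (\<lambda>t. ennreal \<bar>f t\<bar>) \<le> 1 \<Longrightarrow>
    integrable M01 f \<and> (\<integral>s. \<bar>f s\<bar> \<partial>M01) \<le> L"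
proof -
  obtain C where C: "0 < C" "\<And>f. f \<in> borel_measurable M01 \<Longrightarrow> (\<integral>\<^sup>+ t. f t \<partial>M01) \<le> ennreal C * \<rho>X f"
    using ri_norm_L1_bound[OF X] by metis
  have "integrable M01 f \<and> (\<integral>s. \<bar>f s\<bar> \<partial>M01) \<le> C"
    if [measurable]: "f \<in> borel_measurable M01" and f: "\<rho>X (\<lambda>t. ennreal \<bar>f t\<bar>) \<le> 1" for f
  proof -
    have "(\<integral>\<^sup>+ t. ennreal \<bar>f t\<bar> \<partial>M01) \<le> ennreal C * \<rho>X (\<lambda>t. ennreal \<bar>f t\<bar>)"
      by (intro C) auto
    also have "\<dots> \<le> ennreal C * 1" using f by (intro mult_left_mono) auto
    finally have le: "(\<integral>\<^sup>+ t. ennreal \<bar>f t\<bar> \<partial>M01) \<le> ennreal C" by simp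
    then have "integrable M01 f"
      by (intro integrableI_bounded) (auto simp: le_less_trans[OF _ ennreal_less_top])
    moreover have "(\<integral>s. \<bar>f s\<bar> \<partial>M01) = enn2real (\<integral>\<^sup>+ t. ennreal \<bar>f t\<bar> \<partial>M01)"
      by (intro integral_eq_nn_integral) auto
    moreover have "\<dots> \<le> C" using le C by (intro enn2real_leI) auto
    ultimately show ?thesis by simp
  qed
  with C(1) show ?thesis by (intro that[of C]) auto
qed

text \<open>Uniform integrability makes the functions \<^term>\<open>G (f n) m\<close> equicontinuous on \<open>[\<delta>, 1)\<close>, so
convergence on a fine rational grid is uniform convergence.\<close>

lemma G_uniformly_Cauchy:
  assumes fm [measurable]: "\<And>n. f n \<in> borel_measurable M01"
    and f: "\<And>n. \<rho>X (\<lambda>t. ennreal \<bar>f n t\<bar>) \<le> 1"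
    and conv: "\<And>m q. m < j \<Longrightarrow> q \<in> \<rat> \<Longrightarrow> 0 < q \<Longrightarrow> q < 1 \<Longrightarrow> convergent (\<lambda>n. G (f n) m q)"
    and \<delta>: "\<delta> = 1 / real (Suc k)" and "0 < \<eta>"
  shows "\<exists>N. \<forall>n\<ge>N. \<forall>n'\<ge>N. \<forall>m<j. \<forall>x. \<delta> \<le> x \<longrightarrow> x < 1 \<longrightarrow> \<bar>G (f n) m x - G (f n') m x\<bar> \<le> \<eta>"
proof -
  have "0 < \<delta>" using \<delta> by simp
  then have W: "0 < W \<delta>" by (rule W_pos)
  \<comment> \<open>Two moves to a grid point cost \<open>W \<delta> * \<epsilon>\<close>, that is
    \<eta>/3, each; the two deviations from the limit at that point cost \<eta>/6 each.\<close>
  define \<epsilon> where "\<epsilon> = \<eta> / (3 * W \<delta>)"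
  have "0 < \<epsilon>" using W \<open>0 < \<eta>\<close> by (simp add: \<epsilon>_def)
  obtain a where a: "0 < a" "\<And>f E. f \<in> borel_measurable M01 \<Longrightarrow> \<rho>X f \<le> 1 \<Longrightarrow> E \<in> sets M01 \<Longrightarrow>
    emeasure M01 E \<le> ennreal a \<Longrightarrow> (\<integral>\<^sup>+ t. f t * indicator E t \<partial>M01) \<le> ennreal \<epsilon>"
    using ri_ball_uniformly_integrable[OF X XL1 \<open>0 < \<epsilon>\<close>] by blast
  obtain N0 where N0: "1 / real (Suc N0) < a" by (rule nat_approx_posE[OF a(1)])
  \<comment> \<open>The factor \<open>Suc N0\<close> makes the mesh at most \<open>a\<close>. The
    factor \<open>Suc k\<close> makes \<delta> itself the grid point of index \<open>Suc N0\<close>,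
    so that rounding some x \<ge> \<delta> down to the grid stays in [\<delta>,1).\<close>
  define M where "M = Suc k * Suc N0"
  have "0 < M" by (simp add: M_def)
  have "Suc N0 \<le> M" by (simp add: M_def)
  then have "1 / real M \<le> 1 / real (Suc N0)"
    using \<open>0 < M\<close> by (intro divide_left_mono mult_pos_pos) auto
  then have Ma: "1 / real M \<le> a" using N0 by simp
  let ?q = "\<lambda>i::nat. real i / real M"
  define l where "l m q = lim (\<lambda>n. G (f n) m q)" for m q
  have "\<forall>\<^sub>F n in sequentially. \<forall>(m, i) \<in> {..<j} \<times> {1..<M}. \<bar>G (f n) m (?q i) - l m (?q i)\<bar> < \<eta> / 6"
  proof (rule eventually_ball_finite)
    have "\<forall>\<^sub>F n in sequentially. \<bar>G (f n) m (?q i) - l m (?q i)\<bar> < \<eta> / 6"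
      if "m < j" "1 \<le> i" "i < M" for m i
    proof -
      have "convergent (\<lambda>n. G (f n) m (?q i))"
        using \<open>0 < M\<close> that by (intro conv) auto
      then have "(\<lambda>n. G (f n) m (?q i)) \<longlonglongrightarrow> l m (?q i)"
        unfolding l_def by (rule convergent_LIMSEQ_iff[THEN iffD1])
      from tendstoD[OF this, of "\<eta> / 6"] \<open>0 < \<eta>\<close>
      show ?thesis
        by (simp add: dist_real_def)
    qed
    then show "\<forall>y\<in>{..<j} \<times> {1..<M}. \<forall>\<^sub>F n in sequentially.
        case y of (m, i) \<Rightarrow> \<bar>G (f n) m (?q i) - l m (?q i)\<bar> < \<eta> / 6"
      by auto
    show "finite ({..<j} \<times> {1..<M})" by simp
  qed
  then obtain N where N: "\<And>n m i. N \<le> n \<Longrightarrow> m < j \<Longrightarrow> 1 \<le> i \<Longrightarrow> i < M \<Longrightarrow>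
      \<bar>G (f n) m (?q i) - l m (?q i)\<bar> < \<eta> / 6"
    unfolding eventually_sequentially by fastforce
  have close: "\<bar>G (f n) m (?q i) - G (f n) m x\<bar> \<le> \<eta> / 3"
    if "m < j" "\<delta> \<le> ?q i" "?q i \<le> x" "x - ?q i \<le> a" "x < 1" for n m i x
  proof -
    let ?I = "{?q i..<x}"
    have "0 < ?q i" using \<open>0 < \<delta>\<close> that by simp
    then have I: "?I \<in> sets M01" using that by (auto simp: sets_M01)
    have "emeasure M01 ?I = ennreal (x - ?q i)"
      using I that by (subst emeasure_M01) (auto simp: sets_M01)
    then have "emeasure M01 ?I \<le> ennreal a" using that by (simp add: ennreal_leI)
    then have "(\<integral>\<^sup>+ t. ennreal \<bar>f n t\<bar> * indicator ?I t \<partial>M01) \<le> ennreal \<epsilon>"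
      using I f by (intro a) auto
    moreover have "(\<integral>\<^sup>+ t. ennreal \<bar>f n t\<bar> * indicator ?I t \<partial>M01)
        = (\<integral>\<^sup>+ t. ennreal (\<bar>f n t\<bar> * indicator ?I t) \<partial>M01)"
      by (intro nn_integral_cong) (auto split: split_indicator)
    moreover have "(\<integral>t. \<bar>f n t\<bar> * indicator ?I t \<partial>M01) = enn2real (\<integral>\<^sup>+ t. ennreal (\<bar>f n t\<bar> * indicator ?I t) \<partial>M01)"
      using I by (intro integral_eq_nn_integral) auto
    ultimately have "(\<integral>t. \<bar>f n t\<bar> * indicator ?I t \<partial>M01) \<le> \<epsilon>"
      using \<open>0 < \<epsilon>\<close> by (simp add: enn2real_leI)
    then have "W \<delta> * (\<integral>t. \<bar>f n t\<bar> * indicator ?I t \<partial>M01) \<le> W \<delta> * \<epsilon>"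
      using W by (intro mult_left_mono) auto
    also have "\<dots> = \<eta> / 3" using W by (simp add: \<epsilon>_def)
    finally have "W \<delta> * (\<integral>t. \<bar>f n t\<bar> * indicator ?I t \<partial>M01) \<le> \<eta> / 3" .
    moreover have "integrable M01 (f n)" using integral_le_on_ball fm f by metis
    then have "\<bar>G (f n) m (?q i) - G (f n) m x\<bar> \<le> W \<delta> * (\<integral>t. \<bar>f n t\<bar> * indicator ?I t \<partial>M01)"
      using that \<open>0 < \<delta>\<close> by (intro G_diff_bound) auto
    ultimately show ?thesis by linarith
  qed
  show ?thesis
  proof (intro exI[of _ N] allI impI)
    fix n n' m x assume n: "N \<le> n" "N \<le> n'" and m: "m < j" and x: "\<delta> \<le> x" "x < 1"
    define i where "i = nat \<lfloor>x * real M\<rfloor>"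
    have "0 < x" using x \<open>0 < \<delta>\<close> by simp
    then have i: "i < M" "?q i \<le> x" "x < real (Suc i) / real M"
      using grid_floor[of x M M] x \<open>0 < M\<close> unfolding i_def by auto
    have \<delta>M: "real (Suc N0) = \<delta> * real M"
      unfolding \<delta> M_def of_nat_mult by (simp del: of_nat_Suc)
    also have "\<dots> \<le> x * real M" using x by (intro mult_right_mono) auto
    finally have "Suc N0 \<le> i" unfolding i_def by linarith
    then have "real (Suc N0) / real M \<le> ?q i" by (intro divide_right_mono) auto
    then have "\<delta> \<le> ?q i" using \<open>0 < M\<close> unfolding \<delta>M by simp
    have "x - ?q i \<le> 1 / real M" using i(3) by (simp add: add_divide_distrib)
    then have "x - ?q i \<le> a" using Ma by simp
    then have "\<bar>G (f n) m (?q i) - G (f n) m x\<bar> \<le> \<eta> / 3" "\<bar>G (f n') m (?q i) - G (f n') m x\<bar> \<le> \<eta> / 3"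
      using close m \<open>\<delta> \<le> ?q i\<close> i x by auto
    moreover have "\<bar>G (f n) m (?q i) - l m (?q i)\<bar> < \<eta> / 6" "\<bar>G (f n') m (?q i) - l m (?q i)\<bar> < \<eta> / 6"
      using N n m i \<open>Suc N0 \<le> i\<close> by auto
    ultimately show "\<bar>G (f n) m x - G (f n') m x\<bar> \<le> \<eta>" by linarith
  qed
qed

lemma G_convergent_subsequence:
  assumes fm: "\<And>n. f n \<in> borel_measurable M01"
    and f: "\<And>n. \<rho>X (\<lambda>t. ennreal \<bar>f n t\<bar>) \<le> 1"
  obtains r :: "nat \<Rightarrow> nat" where "strict_mono r"
    "\<And>m q. m < j \<Longrightarrow> q \<in> \<rat> \<Longrightarrow> 0 < q \<Longrightarrow> q < 1 \<Longrightarrow> convergent (\<lambda>n. G (f (r n)) m q)"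
proof -
  obtain L where L: "0 < L" "\<And>f. f \<in> borel_measurable M01 \<Longrightarrow> \<rho>X (\<lambda>t. ennreal \<bar>f t\<bar>) \<le> 1 \<Longrightarrow>
    integrable M01 f \<and> (\<integral>s. \<bar>f s\<bar> \<partial>M01) \<le> L"
    using integral_le_on_ball by metis
  define S where "S = {..<j} \<times> (\<rat> \<inter> {0<..<1::real})"
  \<comment> \<open>The diagonal argument asks for one bound over all of \<open>S\<close>, but the
    bound on \<open>G\<close> grows with \<open>W q\<close>; dividing by \<open>W q\<close> leaves
    the uniform bound \<open>L\<close>.\<close>
  define F where "F n x = G (f n) (fst x) (snd x) / W (snd x)" for n x
  have count: "countable S" unfolding S_def by (intro countable_SIGMA countable_Int1 countable_rat) auto
  have bd: "norm (F n x) \<le> L" if "x \<in> S" for n x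
  proof -
    obtain m q where x: "x = (m, q)" "m < j" "0 < q" using \<open>x \<in> S\<close> by (auto simp: S_def)
    have "\<bar>G (f n) m q\<bar> \<le> W q * (\<integral>s. \<bar>f n s\<bar> \<partial>M01)"
      using x L(2)[OF fm f] by (intro G_bound) auto
    also have "\<dots> \<le> W q * L" using L(2)[OF fm f] W_pos[OF \<open>0 < q\<close>] by (intro mult_left_mono) auto
    finally show ?thesis using W_pos[OF \<open>0 < q\<close>] x by (simp add: F_def abs_divide divide_le_eq mult.commute)
  qed
  obtain r :: "nat \<Rightarrow> nat" where r: "strict_mono r" "\<And>x. x \<in> S \<Longrightarrow> \<exists>l. (\<lambda>n. F (r n) x) \<longlonglongrightarrow> l"
  proof (rule function_convergent_subsequence[of S F L, OF count bd])
    fix k :: "nat \<Rightarrow> nat"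
    assume k: "strict_mono k" "\<And>x. x \<in> S \<Longrightarrow> \<exists>l. (\<lambda>n. F (k n) x) \<longlonglongrightarrow> l"
    show thesis by (rule that[OF k])
  qed
  have "convergent (\<lambda>n. G (f (r n)) m q)" if mq: "m < j" "q \<in> \<rat>" "0 < q" "q < 1" for m q
  proof -
    obtain l where "(\<lambda>n. G (f (r n)) m q / W q) \<longlonglongrightarrow> l" using r(2)[of "(m, q)"] mq by (auto simp: S_def F_def)
    then have "(\<lambda>n. G (f (r n)) m q / W q * W q) \<longlonglongrightarrow> l * W q" by (intro tendsto_mult) auto
    then show ?thesis using W_pos[of q] mq by (auto simp: convergent_def)
  qed
  with r(1) show ?thesis by (rule that)
qed

text \<open>Condition (ii) speaks of small sets only. Cutting (0,1) into M cells of measure at most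
  \<open>a\<close> splits the image into M pieces of norm at most 1.\<close>

lemma Hop_norm_finite:
  assumes uniformly_small and [measurable]: "f \<in> borel_measurable M01"
    and f: "\<rho>X (\<lambda>t. ennreal \<bar>f t\<bar>) \<le> 1"
  shows "\<rho>Y (Hop J j (\<lambda>s. ennreal \<bar>f s\<bar>)) < \<infinity>"
proof -
  obtain a where a: "0 < a" "\<And>E. E \<in> sets M01 \<Longrightarrow> emeasure M01 E \<le> ennreal a \<Longrightarrow>
     \<rho>Y (Hop J j (\<lambda>s. ennreal \<bar>indicator E s * f s\<bar>)) \<le> ennreal 1"
    using assms unfolding uniformly_small_def by (meson zero_less_one)
  obtain N0 where N0: "1 / real (Suc N0) < a" by (rule nat_approx_posE[OF a(1)])
  define M where "M = Suc N0"
  have M: "0 < M" "1 / real M \<le> a" using N0 by (auto simp: M_def)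
  let ?I = "\<lambda>k. {real k / real M..<real (Suc k) / real M} \<inter> {0<..<1}"
  have I [measurable]: "?I k \<in> sets M01" for k by (auto simp: sets_M01)
  let ?g = "\<lambda>k s. ennreal \<bar>indicator (?I k) s * f s\<bar>"
  have "\<rho>Y (Hop J j (\<lambda>s. ennreal \<bar>f s\<bar>)) \<le> \<rho>Y (\<lambda>t. \<Sum>k<M. Hop J j (?g k) t)"
  proof (rule ri_norm_mono[OF Y])
    fix t :: real assume t: "0 < t" "t < 1"
    have "Hop J j (\<lambda>s. ennreal \<bar>f s\<bar>) t \<le> Hop J j (\<lambda>s. \<Sum>k<M. ?g k s) t"
    proof (intro Hop_mono AE_I2)
      fix s assume "s \<in> space M01"
      then have s: "0 < s" "s < 1" by (auto simp: space_M01)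
      define k where "k = nat \<lfloor>s * real M\<rfloor>"
      have k: "k < M" "s \<in> ?I k"
        using grid_floor[of s M M] s M unfolding k_def by auto
      then have "ennreal \<bar>f s\<bar> = ?g k s" by simp
      also have "\<dots> \<le> (\<Sum>k<M. ?g k s)" using k by (intro member_le_sum) auto
      finally show "ennreal \<bar>f s\<bar> \<le> (\<Sum>k<M. ?g k s)" .
    qed (use t in auto)
    also have "\<dots> = (\<Sum>k<M. Hop J j (?g k) t)" using t by (intro Hop_sum) auto
    finally show "Hop J j (\<lambda>s. ennreal \<bar>f s\<bar>) t \<le> (\<Sum>k<M. Hop J j (?g k) t)" .
  qed auto
  also have "\<dots> \<le> (\<Sum>k<M. \<rho>Y (Hop J j (?g k)))" by (rule ri_norm_sum[OF Y]) auto
  also have "\<dots> \<le> (\<Sum>k<M. ennreal 1)"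
  proof (intro sum_mono a I)
    fix k
    show "emeasure M01 (?I k) \<le> ennreal a"
      using emeasure_M01_grid_le[OF M(1), of k] M(2) by (meson ennreal_leI order_trans)
  qed
  also have "\<dots> < \<infinity>" by (simp add: of_nat_less_top)
  finally show ?thesis .
qed

text \<open>The limit is built pointwise: the images form a Cauchy sequence at every point and in
  the norm of Y, and letting the second index tend to infinity under \<open>ri_norm_Fatou\<close>
  turns the norm Cauchy estimate into convergence.\<close>

lemma ball_compact:
  assumes small: uniformly_small and fm [measurable]: "\<And>n. f n \<in> borel_measurable M01"
    and f: "\<And>n. \<rho>X (\<lambda>t. ennreal \<bar>f n t\<bar>) \<le> 1"
  obtains r :: "nat \<Rightarrow> nat" and g where "strict_mono r" "g \<in> ri_space \<rho>Y"
    "(\<lambda>n. \<rho>Y (\<lambda>t. ennreal \<bar>enn2real (Hop J j (\<lambda>s. ennreal \<bar>f (r n) s\<bar>) t) - g t\<bar>)) \<longlonglongrightarrow> 0"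
proof -
  obtain r :: "nat \<Rightarrow> nat" where r: "strict_mono r" and
    conv: "\<And>m q. m < j \<Longrightarrow> q \<in> \<rat> \<Longrightarrow> 0 < q \<Longrightarrow> q < 1 \<Longrightarrow> convergent (\<lambda>n. G (f (r n)) m q)"
    using G_convergent_subsequence[of f] fm f by metis
  have int: "integrable M01 (f n)" for n using integral_le_on_ball fm f by metis
  define h where "h n s = ennreal \<bar>f (r n) s\<bar>" for n s
  have hm [measurable]: "h n \<in> borel_measurable M01" for n unfolding h_def by measurable
  define u where "u n t = enn2real (Hop J j (h n) t)" for n t
  have um [measurable]: "u n \<in> borel_measurable M01" for n unfolding u_def by measurable
  have hfin: "(\<integral>\<^sup>+ s. h n s \<partial>M01) < \<infinity>" for n
    using int[of "r n"] by (simp add: h_def integrable_iff_bounded)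
  have Hfin: "Hop J j g t < \<infinity>" if "g \<in> borel_measurable M01" "\<And>s. g s \<le> h n s" "0 < t" "t < 1" for n t g
  proof -
    have "Hop J j g t \<le> ennreal (W t) * (\<integral>\<^sup>+ s. g s \<partial>M01)"
      using that by (intro Hop_le) auto
    also have "\<dots> \<le> ennreal (W t) * (\<integral>\<^sup>+ s. h n s \<partial>M01)"
      using that by (intro mult_left_mono nn_integral_mono) auto
    also have "\<dots> < \<infinity>" using hfin[of n] by (simp add: ennreal_mult_less_top)
    finally show ?thesis .
  qed
  define S where "S = (\<Sum>i\<le>j - 1. \<bar>coef i\<bar>)"
  have "0 \<le> S" by (simp add: S_def sum_nonneg)
  let ?D = "\<lambda>\<delta> n. Hop J j (\<lambda>s. h n s * indicator {\<delta>..} s)"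
  have cm: "(\<lambda>s. h n s * indicator {\<delta>..} s) \<in> borel_measurable M01" for n \<delta>
    by (intro borel_measurable_times_ennreal indicator_borel_measurable_M01) auto
  \<comment> \<open>The estimate covers all t in (0,1), also below \<delta>; the weight
    \<open>1 + \<Phi> t ^ j\<close> absorbs any growth there.\<close>
  have D_Cauchy: "\<exists>N. \<forall>n\<ge>N. \<forall>n'\<ge>N. \<forall>t. 0 < t \<longrightarrow> t < 1 \<longrightarrow>
      \<bar>enn2real (?D \<delta> n t) - enn2real (?D \<delta> n' t)\<bar> \<le> \<eta> * S * (1 + \<Phi> t ^ j)"
    if \<delta>: "\<delta> = 1 / real (Suc k)" "\<delta> < 1" and "0 < \<eta>" for \<delta> k \<eta>
  proof -
    have "\<exists>N. \<forall>n\<ge>N. \<forall>n'\<ge>N. \<forall>m<j. \<forall>x. \<delta> \<le> x \<longrightarrow> x < 1 \<longrightarrow> \<bar>G (f (r n)) m x - G (f (r n')) m x\<bar> \<le> \<eta>"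
      using f conv \<delta>(1) \<open>0 < \<eta>\<close> by (intro G_uniformly_Cauchy) auto
    then obtain N where N: "\<And>n n' m x. N \<le> n \<Longrightarrow> N \<le> n' \<Longrightarrow> m < j \<Longrightarrow> \<delta> \<le> x \<Longrightarrow> x < 1 \<Longrightarrow>
      \<bar>G (f (r n)) m x - G (f (r n')) m x\<bar> \<le> \<eta>" by blast
    have "0 < \<delta>" using \<delta> by simp
    then show ?thesis
      unfolding h_def S_def using N \<delta>(2) int
      by (intro exI[of _ N] allI impI Hop_diff_bound) auto
  qed
  define g where "g t = lim (\<lambda>n. u n t)" for t
  have gm [measurable]: "g \<in> borel_measurable M01" unfolding g_def by measurable
  have lim: "(\<lambda>n. u n t) \<longlonglongrightarrow> g t" if t: "0 < t" "t < 1" for t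
  proof -
    \<comment> \<open>A cutoff below t is invisible to H at t, because \<open>kern t\<close>
      vanishes to the left of t. Hence \<open>D_Cauchy\<close> for some \<delta> < t already gives
      the Cauchy property at t.\<close>
    obtain k where "1 / real (Suc k) < t" by (rule nat_approx_posE[OF t(1)])
    define \<delta> where "\<delta> = 1 / real (Suc k)"
    have \<delta>: "\<delta> < t" "\<delta> < 1" using \<open>1 / real (Suc k) < t\<close> t unfolding \<delta>_def by linarith+
    have u: "u n t = enn2real (?D \<delta> n t)" for n
    proof -
      have "Hop J j (h n) t = ?D \<delta> n t"
        unfolding Hop_eq[OF hm t] Hop_eq[OF cm t] using \<delta>
        by (intro nn_integral_cong) (auto simp: kern_def split: split_indicator)
      then show ?thesis by (simp add: u_def)
    qed
    have "Cauchy (\<lambda>n. u n t)"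
    proof (rule metric_CauchyI)
      fix e :: real assume "0 < e"
      have "0 \<le> S * (1 + \<Phi> t ^ j)" using \<open>0 \<le> S\<close> \<Phi>_nonneg[of t] by simp
      then obtain \<eta> where "0 < \<eta>" "\<eta> * (S * (1 + \<Phi> t ^ j)) < e"
        using \<open>0 < e\<close> by (rule exists_small_factor)
      then have "\<eta> * S * (1 + \<Phi> t ^ j) < e" by (simp add: mult.assoc)
      then show "\<exists>M. \<forall>m\<ge>M. \<forall>n\<ge>M. dist (u m t) (u n t) < e"
        using D_Cauchy[OF \<delta>_def \<delta>(2) \<open>0 < \<eta>\<close>] t unfolding u dist_real_def by (meson le_less_trans)
    qed
    then show ?thesis
      unfolding g_def by (simp add: Cauchy_convergent_iff convergent_LIMSEQ_iff)
  qed
  \<comment> \<open>A bound, by the triangle inequality, for the norm in Y of the weight in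
    \<open>D_Cauchy\<close>.\<close>
  define Q where "Q = \<rho>Y (\<lambda>t. 1) + \<rho>Y (\<lambda>t. (Jint J t 1) ^ j)"
  have "Q < \<infinity>" using ri_norm_one_finite[OF Y] Yfin by (simp add: Q_def)
  have J1m: "(\<lambda>t. (Jint J t 1) ^ j) \<in> borel_measurable M01"
    by (rule antimono_on_borel_measurable_M01) (auto simp: Jint_1_eq \<Phi>_antimono intro!: power_mono ennreal_leI)
  have Cauchy: "\<exists>N. \<forall>n\<ge>N. \<forall>n'\<ge>N. \<rho>Y (\<lambda>t. ennreal \<bar>u n t - u n' t\<bar>) \<le> ennreal e" if "0 < e" for e
  proof -
    have e3: "0 < e / 3" using that by simp
    obtain a where a: "0 < a" "\<And>f E. f \<in> borel_measurable M01 \<Longrightarrow> \<rho>X (\<lambda>t. ennreal \<bar>f t\<bar>) \<le> 1 \<Longrightarrow>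
       E \<in> sets M01 \<Longrightarrow> emeasure M01 E \<le> ennreal a \<Longrightarrow>
       \<rho>Y (Hop J j (\<lambda>s. ennreal \<bar>indicator E s * f s\<bar>)) \<le> ennreal (e / 3)"
      using small e3 unfolding uniformly_small_def by blast
    \<comment> \<open>Below \<open>a\<close>, so that (ii) applies on (0,\<delta>); below 1, so that
      \<open>max t \<delta>\<close> stays in [\<delta>,1), where the separated integrals converge
      uniformly.\<close>
    have "0 < min a 1" using a by simp
    then obtain k where "1 / real (Suc k) < min a 1" by (rule nat_approx_posE)
    define \<delta> where "\<delta> = 1 / real (Suc k)"
    have \<delta>: "0 < \<delta>" "\<delta> < a" "\<delta> < 1" using \<open>1 / real (Suc k) < min a 1\<close> by (simp_all only: \<delta>_def) auto
    have "0 \<le> S * enn2real Q" using \<open>0 \<le> S\<close> by simp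
    then obtain \<eta> where "0 < \<eta>" "\<eta> * (S * enn2real Q) < e / 3"
      using e3 by (rule exists_small_factor)
    then have le: "\<eta> * S * enn2real Q \<le> e / 3" by (simp add: mult.assoc)
    define A where "A n = Hop J j (\<lambda>s. ennreal \<bar>indicator {0<..<\<delta>} s * f (r n) s\<bar>)" for n
    have [measurable]: "A n \<in> borel_measurable M01" for n unfolding A_def by measurable
    have sd: "{0<..<\<delta>} \<in> sets M01" using \<delta> by (auto simp: sets_M01)
    have A: "\<rho>Y (A n) \<le> ennreal (e / 3)" for n
      unfolding A_def using sd \<delta> f by (intro a) (auto simp: emeasure_M01_Ioo intro: ennreal_leI)
    have Am: "(\<lambda>s. ennreal \<bar>indicator {0<..<\<delta>} s * f (r n) s\<bar>) \<in> borel_measurable M01" for n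
      using sd by measurable
    \<comment> \<open>Finiteness of both parts is what makes \<open>enn2real\<close> additive
      here.\<close>
    have split: "u n t = enn2real (A n t) + enn2real (?D \<delta> n t)" and Afin: "A n t < \<infinity>" if t: "0 < t" "t < 1" for n t
    proof -
      have "Hop J j (h n) t = Hop J j (\<lambda>s. ennreal \<bar>indicator {0<..<\<delta>} s * f (r n) s\<bar> + h n s * indicator {\<delta>..} s) t"
      proof (intro antisym Hop_mono AE_I2 t)
        fix s assume "s \<in> space M01"
        then have "h n s = ennreal \<bar>indicator {0<..<\<delta>} s * f (r n) s\<bar> + h n s * indicator {\<delta>..} s"
          by (auto simp: space_M01 h_def split: split_indicator)
        then show "h n s \<le> ennreal \<bar>indicator {0<..<\<delta>} s * f (r n) s\<bar> + h n s * indicator {\<delta>..} s"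
          "ennreal \<bar>indicator {0<..<\<delta>} s * f (r n) s\<bar> + h n s * indicator {\<delta>..} s \<le> h n s" by simp_all
      qed (use Am cm in auto)
      also have "\<dots> = A n t + ?D \<delta> n t" unfolding A_def using t Am cm by (intro Hop_add) auto
      finally have eq: "Hop J j (h n) t = A n t + ?D \<delta> n t" .
      show "A n t < \<infinity>" unfolding A_def using t Am
        by (intro Hfin[where n = n]) (auto simp: h_def split: split_indicator)
      moreover have "?D \<delta> n t < \<infinity>" using t cm
        by (intro Hfin[where n = n]) (auto split: split_indicator)
      ultimately show "u n t = enn2real (A n t) + enn2real (?D \<delta> n t)"
        unfolding u_def eq by (intro enn2real_plus) (auto simp: less_top)
    qed
    obtain N where N: "\<And>n n' t. N \<le> n \<Longrightarrow> N \<le> n' \<Longrightarrow> 0 < t \<Longrightarrow> t < 1 \<Longrightarrow>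
      \<bar>enn2real (?D \<delta> n t) - enn2real (?D \<delta> n' t)\<bar> \<le> \<eta> * S * (1 + \<Phi> t ^ j)"
      using D_Cauchy[OF \<delta>_def \<delta>(3) \<open>0 < \<eta>\<close>] by blast
    let ?R = "\<lambda>t. ennreal (\<eta> * S) * (1 + (Jint J t 1) ^ j)"
    have Rm: "?R \<in> borel_measurable M01" using J1m by measurable
    have "\<rho>Y (\<lambda>t. ennreal \<bar>u n t - u n' t\<bar>) \<le> ennreal e" if n: "N \<le> n" "N \<le> n'" for n n'
    proof -
      have "\<rho>Y (\<lambda>t. ennreal \<bar>u n t - u n' t\<bar>) \<le> \<rho>Y (\<lambda>t. (A n t + A n' t) + ?R t)"
      proof (rule ri_norm_mono[OF Y])
        fix t :: real assume t: "0 < t" "t < 1"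
        have "\<bar>u n t - u n' t\<bar> \<le> (enn2real (A n t) + enn2real (A n' t)) + \<eta> * S * (1 + \<Phi> t ^ j)"
          unfolding split[OF t] using N[OF n t] enn2real_nonneg[of "A n t"] enn2real_nonneg[of "A n' t"]
          by linarith
        then have "ennreal \<bar>u n t - u n' t\<bar>
          \<le> ennreal ((enn2real (A n t) + enn2real (A n' t)) + \<eta> * S * (1 + \<Phi> t ^ j))"
          by (rule ennreal_leI)
        also have "\<dots> = (A n t + A n' t) + ?R t"
          using Afin[OF t, of n] Afin[OF t, of n'] \<open>0 < \<eta>\<close> \<open>0 \<le> S\<close> \<Phi>_nonneg[of t] t
          by (simp add: ennreal_plus ennreal_mult Jint_1_eq ennreal_power less_top)
        finally show "ennreal \<bar>u n t - u n' t\<bar> \<le> (A n t + A n' t) + ?R t" .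
      qed (use Rm in auto)
      also have "\<dots> \<le> \<rho>Y (\<lambda>t. A n t + A n' t) + \<rho>Y ?R"
        using Rm by (intro ri_norm_add[OF Y]) auto
      also have "\<dots> \<le> (\<rho>Y (A n) + \<rho>Y (A n')) + \<rho>Y ?R"
        by (intro add_right_mono ri_norm_add[OF Y]) auto
      also have "\<dots> \<le> (ennreal (e / 3) + ennreal (e / 3)) + ennreal (e / 3)"
      proof (intro add_mono A)
        have "\<rho>Y ?R = ennreal (\<eta> * S) * \<rho>Y (\<lambda>t. 1 + (Jint J t 1) ^ j)"
          using J1m \<open>0 < \<eta>\<close> \<open>0 \<le> S\<close> by (intro ri_norm_scale[OF Y]) auto
        also have "\<dots> \<le> ennreal (\<eta> * S) * Q"
          unfolding Q_def using J1m by (intro mult_left_mono ri_norm_add[OF Y]) auto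
        also have "\<dots> = ennreal (\<eta> * S * enn2real Q)"
          using \<open>0 < \<eta>\<close> \<open>0 \<le> S\<close> \<open>Q < \<infinity>\<close> by (subst ennreal_mult) (auto simp: less_top)
        also have "\<dots> \<le> ennreal (e / 3)" using le by (rule ennreal_leI)
        finally show "\<rho>Y ?R \<le> ennreal (e / 3)" .
      qed
      also have "\<dots> = ennreal e" using e3 by (simp add: ennreal_plus[symmetric] del: ennreal_plus)
      finally show ?thesis .
    qed
    then show ?thesis by blast
  qed
  have norm_lim: "\<exists>N. \<forall>n\<ge>N. \<rho>Y (\<lambda>t. ennreal \<bar>u n t - g t\<bar>) \<le> ennreal e" if e: "0 < e" for e
  proof -
    obtain N where N: "\<And>n n'. N \<le> n \<Longrightarrow> N \<le> n' \<Longrightarrow> \<rho>Y (\<lambda>t. ennreal \<bar>u n t - u n' t\<bar>) \<le> ennreal e"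
      using Cauchy[OF e] by blast
    have "\<rho>Y (\<lambda>t. ennreal \<bar>u n t - g t\<bar>) \<le> ennreal e" if "N \<le> n" for n
    proof (rule ri_norm_Fatou[OF Y, where v = "\<lambda>n' t. ennreal \<bar>u n t - u n' t\<bar>" and N = N])
      fix t :: real assume "0 < t" "t < 1"
      then show "(\<lambda>n'. ennreal \<bar>u n t - u n' t\<bar>) \<longlonglongrightarrow> ennreal \<bar>u n t - g t\<bar>"
        by (intro tendsto_ennrealI tendsto_rabs tendsto_diff lim) auto
    qed (use N that in auto)
    then show ?thesis by blast
  qed
  have "g \<in> ri_space \<rho>Y"
  proof -
    \<comment> \<open>One image within distance 1 of \<open>g\<close> suffices, since every image
      has finite norm by \<open>Hop_norm_finite\<close>.\<close>
    obtain N where N: "\<rho>Y (\<lambda>t. ennreal \<bar>u N t - g t\<bar>) \<le> ennreal 1"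
      using norm_lim[of 1] by auto
    have "\<rho>Y (\<lambda>t. ennreal \<bar>g t\<bar>) \<le> \<rho>Y (\<lambda>t. ennreal \<bar>u N t - g t\<bar> + Hop J j (h N) t)"
    proof (rule ri_norm_mono[OF Y])
      fix t :: real assume t: "0 < t" "t < 1"
      have "ennreal \<bar>g t\<bar> \<le> ennreal (\<bar>u N t - g t\<bar> + enn2real (Hop J j (h N) t))"
        using enn2real_nonneg[of "Hop J j (h N) t"] unfolding u_def by (intro ennreal_leI) linarith
      also have "\<dots> = ennreal \<bar>u N t - g t\<bar> + Hop J j (h N) t"
        using Hfin[of "h N" N t] t by (simp add: ennreal_plus less_top)
      finally show "ennreal \<bar>g t\<bar> \<le> ennreal \<bar>u N t - g t\<bar> + Hop J j (h N) t" .
    qed auto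
    also have "\<dots> \<le> \<rho>Y (\<lambda>t. ennreal \<bar>u N t - g t\<bar>) + \<rho>Y (Hop J j (h N))"
      by (intro ri_norm_add[OF Y]) auto
    also have "\<dots> < \<infinity>"
      using N Hop_norm_finite[OF small fm f, of "r N"]
      by (auto simp: h_def[abs_def] intro: le_less_trans)
    finally show ?thesis by (simp add: ri_space_def)
  qed
  moreover have "(\<lambda>n. \<rho>Y (\<lambda>t. ennreal \<bar>u n t - g t\<bar>)) \<longlonglongrightarrow> 0"
    unfolding ennreal_tendsto_0_iff_le eventually_sequentially using norm_lim by blast
  ultimately show ?thesis
    using r that[of r g] by (simp add: u_def h_def[abs_def])
qed

text \<open>A bounded sequence is scaled into the unit ball; homogeneity of H and of both norms
  carries the limit back.\<close>

lemma compact_if_uniformly_small: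
  assumes small: uniformly_small
  shows "compact_op \<rho>X \<rho>Y (\<lambda>f. Hop J j (\<lambda>s. ennreal \<bar>f s\<bar>))"
  unfolding compact_op_def
proof (intro allI impI)
  fix f :: "nat \<Rightarrow> real \<Rightarrow> real"
  assume "(\<forall>n. f n \<in> borel_measurable M01) \<and> (\<exists>B. \<forall>n. \<rho>X (\<lambda>t. ennreal \<bar>f n t\<bar>) \<le> ennreal B)"
  then obtain B0 where fm [measurable]: "\<And>n. f n \<in> borel_measurable M01"
    and B0: "\<And>n. \<rho>X (\<lambda>t. ennreal \<bar>f n t\<bar>) \<le> ennreal B0" by blast
  \<comment> \<open>The given bound may be zero or negative; the maximum with 1 allows
    division.\<close>
  define B where "B = max B0 1"
  have "0 < B" by (simp add: B_def)
  have B: "\<rho>X (\<lambda>t. ennreal \<bar>f n t\<bar>) \<le> ennreal B" for n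
    using B0[of n] by (rule order_trans) (auto simp: B_def intro: ennreal_leI)
  define F where "F n t = f n t / B" for n t
  have Fm [measurable]: "F n \<in> borel_measurable M01" for n unfolding F_def by measurable
  have F: "\<rho>X (\<lambda>t. ennreal \<bar>F n t\<bar>) \<le> 1" for n
  proof -
    have "\<rho>X (\<lambda>t. ennreal \<bar>F n t\<bar>) = \<rho>X (\<lambda>t. ennreal (1 / B) * ennreal \<bar>f n t\<bar>)"
      using \<open>0 < B\<close> by (simp add: F_def ennreal_mult[symmetric])
    also have "\<dots> = ennreal (1 / B) * \<rho>X (\<lambda>t. ennreal \<bar>f n t\<bar>)"
      using \<open>0 < B\<close> by (intro ri_norm_scale[OF X]) auto
    also have "\<dots> \<le> ennreal (1 / B) * ennreal B" by (intro mult_left_mono B) auto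
    also have "\<dots> = 1" using \<open>0 < B\<close> by (simp add: ennreal_mult[symmetric])
    finally show ?thesis .
  qed
  define T where "T f = Hop J j (\<lambda>s. ennreal \<bar>f s\<bar>)" for f
  have Tm [measurable]: "T f \<in> borel_measurable M01" for f unfolding T_def by measurable
  have scale: "T (f n) t = ennreal B * T (F n) t" if "0 < t" "t < 1" for n t
  proof -
    have "(\<lambda>s. ennreal \<bar>f n s\<bar>) = (\<lambda>s. ennreal B * ennreal \<bar>F n s\<bar>)"
      using \<open>0 < B\<close> by (simp add: F_def ennreal_mult[symmetric])
    then show ?thesis unfolding T_def using that by (simp add: Hop_scale)
  qed
  have Tfin: "\<rho>Y (T (f n)) < \<infinity>" for n
  proof -
    have "\<rho>Y (T (f n)) \<le> \<rho>Y (\<lambda>t. ennreal B * T (F n) t)"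
      by (intro ri_norm_mono[OF Y]) (auto simp: scale)
    also have "\<dots> = ennreal B * \<rho>Y (T (F n))" using \<open>0 < B\<close> by (intro ri_norm_scale[OF Y]) auto
    also have "\<dots> < \<infinity>"
      using Hop_norm_finite[OF small Fm F, of n] by (simp add: T_def ennreal_mult_less_top)
    finally show ?thesis .
  qed
  obtain r :: "nat \<Rightarrow> nat" and g where r: "strict_mono r" and g: "g \<in> ri_space \<rho>Y"
    and "(\<lambda>n. \<rho>Y (\<lambda>t. ennreal \<bar>enn2real (Hop J j (\<lambda>s. ennreal \<bar>F (r n) s\<bar>) t) - g t\<bar>)) \<longlonglongrightarrow> 0"
    by (rule ball_compact[OF small Fm F])
  then have lim: "(\<lambda>n. \<rho>Y (\<lambda>t. ennreal \<bar>enn2real (T (F (r n)) t) - g t\<bar>)) \<longlonglongrightarrow> 0"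
    by (simp add: T_def)
  have gm [measurable]: "g \<in> borel_measurable M01" using g by (simp add: ri_space_def)
  have "\<rho>Y (\<lambda>t. ennreal \<bar>enn2real (T (f (r n)) t) - B * g t\<bar>)
      = ennreal B * \<rho>Y (\<lambda>t. ennreal \<bar>enn2real (T (F (r n)) t) - g t\<bar>)" for n
  proof -
    have "\<rho>Y (\<lambda>t. ennreal \<bar>enn2real (T (f (r n)) t) - B * g t\<bar>)
      = \<rho>Y (\<lambda>t. ennreal B * ennreal \<bar>enn2real (T (F (r n)) t) - g t\<bar>)"
    proof (rule ri_norm_cong_AE[OF Y])
      show "AE t in M01. ennreal \<bar>enn2real (T (f (r n)) t) - B * g t\<bar>
        = ennreal B * ennreal \<bar>enn2real (T (F (r n)) t) - g t\<bar>"
      proof (rule AE_I2)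
        fix t assume "t \<in> space M01"
        then have "enn2real (T (f (r n)) t) - B * g t = B * (enn2real (T (F (r n)) t) - g t)"
          using \<open>0 < B\<close> by (simp add: space_M01 scale enn2real_mult right_diff_distrib)
        then show "ennreal \<bar>enn2real (T (f (r n)) t) - B * g t\<bar>
          = ennreal B * ennreal \<bar>enn2real (T (F (r n)) t) - g t\<bar>"
          using \<open>0 < B\<close> by (simp add: abs_mult ennreal_mult)
      qed
    qed auto
    also have "\<dots> = ennreal B * \<rho>Y (\<lambda>t. ennreal \<bar>enn2real (T (F (r n)) t) - g t\<bar>)"
      using \<open>0 < B\<close> by (intro ri_norm_scale[OF Y]) auto
    finally show ?thesis .
  qed
  moreover have "(\<lambda>n. ennreal B * \<rho>Y (\<lambda>t. ennreal \<bar>enn2real (T (F (r n)) t) - g t\<bar>)) \<longlonglongrightarrow> ennreal B * 0"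
    by (intro ennreal_tendsto_cmult lim) simp
  moreover have "(\<lambda>t. B * g t) \<in> ri_space \<rho>Y"
  proof -
    have "\<rho>Y (\<lambda>t. ennreal \<bar>B * g t\<bar>) = \<rho>Y (\<lambda>t. ennreal B * ennreal \<bar>g t\<bar>)"
      using \<open>0 < B\<close> by (simp add: abs_mult ennreal_mult)
    also have "\<dots> = ennreal B * \<rho>Y (\<lambda>t. ennreal \<bar>g t\<bar>)"
      using \<open>0 < B\<close> by (intro ri_norm_scale[OF Y]) auto
    also have "\<dots> < \<infinity>" using g by (simp add: ri_space_def ennreal_mult_less_top)
    finally show ?thesis by (simp add: ri_space_def)
  qed
  ultimately show "(\<forall>n. \<rho>Y (Hop J j (\<lambda>s. ennreal \<bar>f n s\<bar>)) < \<infinity>) \<and>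
    (\<exists>r g. strict_mono r \<and> g \<in> ri_space \<rho>Y \<and>
      (\<lambda>n. \<rho>Y (\<lambda>t. ennreal \<bar>enn2real (Hop J j (\<lambda>s. ennreal \<bar>f (r n) s\<bar>) t) - g t\<bar>)) \<longlonglongrightarrow> 0)"
    using r Tfin unfolding T_def by (intro conjI allI exI[of _ r] exI[of _ "\<lambda>t. B * g t"]) auto
qed

end

theorem theorem4p6:
  fixes J :: "real \<Rightarrow> real" and j :: nat
    and \<rho>X \<rho>Y :: "(real \<Rightarrow> ennreal) \<Rightarrow> ennreal"
  assumes J_meas: "J \<in> borel_measurable (lebesgue_on {0<..1})"
    and J_pos: "\<forall>t \<in> {0<..1}. J t > 0"
    and J_inf: "(INF t \<in> {0<..1}. J t / t) > 0"
    and j: "j \<ge> 1"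
    and X: "ri_norm \<rho>X" and XL1: "ri_space \<rho>X \<noteq> L1_space"
    and Y: "ri_norm \<rho>Y" and Yfin: "\<rho>Y (\<lambda>t. (Jint J t 1) ^ j) < \<infinity>"
  shows "(compact_op \<rho>X \<rho>Y (\<lambda>f. Hop J j (\<lambda>s. ennreal \<bar>f s\<bar>))
           \<longleftrightarrow> ((\<lambda>a::real. SUP f \<in> {f \<in> borel_measurable M01. \<rho>X (\<lambda>t. ennreal \<bar>f t\<bar>) \<le> 1}.
                   SUP E \<in> {E \<in> sets M01. emeasure M01 E \<le> ennreal a}.
                     \<rho>Y (Hop J j (\<lambda>s. ennreal \<bar>indicator E s * f s\<bar>))) \<longlongrightarrow> 0) (at_right 0))
       \<and> (compact_op \<rho>X \<rho>Y (\<lambda>f. Hop J j (\<lambda>s. ennreal \<bar>f s\<bar>))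
           \<longleftrightarrow> almost_compact \<rho>X (Yd J j \<rho>Y))"
proof -
  define c where "c = (INF t \<in> {0<..1}. J t / t)"
  have "c * t \<le> J t" if t: "0 < t" "t \<le> 1" for t
  proof -
    \<comment> \<open>A real infimum is a lower bound only for a set that is bounded below;
      positivity of \<open>J\<close> supplies the bound 0.\<close>
    have "bdd_below ((\<lambda>t. J t / t) ` {0<..1})"
      using J_pos by (intro bdd_belowI[of _ 0]) (auto intro: less_imp_le divide_nonneg_pos)
    then have "c \<le> J t / t" unfolding c_def using t by (intro cINF_lower) auto
    then show ?thesis using t by (simp add: le_divide_eq)
  qed
  then interpret hardy_pair J j c \<rho>X \<rho>Y
    using J_meas J_inf j X XL1 Y Yfin by unfold_locales (auto simp: c_def)
  show ?thesis
    unfolding tendsto_iff_uniformly_small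
    using compact_if_uniformly_small uniformly_small_if_compact
      almost_compact_if_uniformly_small uniformly_small_if_almost_compact by blast
qed

end
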